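(* Let $X$ be a proper, $\delta$-hyperbolic metric space, let $\Gamma < \mathrm{Isom}(X)$ be discrete and non-elementary, and let $x\in X$. Then $$\limsup_{T \to +\infty} \frac{1}{T} \log \#(\Gamma x \cap B(x,T)) = \liminf_{T \to +\infty} \frac{1}{T} \log \#(\Gamma x \cap B(x,T)) = h_\Gamma.$$
   Context: For a geodesic metric space $X$ and $x,y,z\in X$ put $(y,z)_x=\frac12\big(d(x,y)+d(x,z)-d(y,z)\big)$. A geodesic metric space $X$ is $\delta$-hyperbolic ($\delta\ge 0$) if $(x,z)_w\ge\min\{(x,y)_w,(y,z)_w\}-\delta$ for all $x,y,z,w\in X$. (So $\delta$-hyperbolic spaces are geodesic by convention.) Proper means that closed balls are compact. $B(x,T)$ is the open ball of center $x$ and radius $T$. $\partial X$ denotes the Gromov boundary of $X$. $\mathrm{Isom}(X)$ is the isometry group of $X$. $\Gamma<\mathrm{Isom}(X)$ is discrete if for every $x\in X$ and $R\ge0$ the set $\{g\in\Gamma: d(x,gx)\le R\}$ is finite. The limit set $\Lambda(\Gamma)$ is the set of accumulation points in $\partial X$ of an orbit $\Gamma x$ (independent of $x$); $\Gamma$ is non-elementary if $\Lambda(\Gamma)$ has more than two points. The critical exponent $h_\Gamma\in[0,+\infty]$ is by definition $\limsup_{T\to+\infty}\frac1T\log\#(\Gamma x\cap B(x,T))$, which is independent of $x\in X$; thus the content is that the limit superior is a true limit. *)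

theory Defs
  imports "HOL-Analysis.Analysis" "HOL-Algebra.Group"
begin

section \<open>Gromov hyperbolic spaces\<close>

definition gromov_product :: "'a::metric_space \<Rightarrow> 'a \<Rightarrow> 'a \<Rightarrow> real" where
  "gromov_product x y z = (dist x y + dist x z - dist y z) / 2"

definition geodesic_space :: "'a::metric_space itself \<Rightarrow> bool" where
  "geodesic_space _ \<longleftrightarrow>
     (\<forall>x y :: 'a. \<exists>\<gamma> :: real \<Rightarrow> 'a. \<gamma> 0 = x \<and> \<gamma> (dist x y) = y \<and>
        (\<forall>s\<in>{0..dist x y}. \<forall>t\<in>{0..dist x y}. dist (\<gamma> s) (\<gamma> t) = \<bar>s - t\<bar>))"

definition proper_space :: "'a::metric_space itself \<Rightarrow> bool" where
  "proper_space _ \<longleftrightarrow> (\<forall>(x :: 'a) r. compact (cball x r))"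

definition hyperbolic_space :: "'a::metric_space itself \<Rightarrow> real \<Rightarrow> bool" where
  "hyperbolic_space _ \<delta> \<longleftrightarrow> geodesic_space TYPE('a) \<and> \<delta> \<ge> 0 \<and>
     (\<forall>x y z w :: 'a. gromov_product w x z \<ge>
        min (gromov_product w x y) (gromov_product w y z) - \<delta>)"


section \<open>The Gromov boundary\<close>

text \<open>
  Changing the base point \<open>w\<close> changes Gromov products by at most the distance between the
  base points, so in the following definitions quantifying over all base points is the same
  as fixing one.
\<close>

definition diverging_product :: "(nat \<Rightarrow> 'a::metric_space) \<Rightarrow> (nat \<Rightarrow> 'a) \<Rightarrow> bool" where
  "diverging_product s t \<longleftrightarrow>
     (\<forall>w. filterlim (\<lambda>(i, j). gromov_product w (s i) (t j)) at_top
            (sequentially \<times>\<^sub>F sequentially))"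

definition gromov_sequences :: "(nat \<Rightarrow> 'a::metric_space) set" where
  "gromov_sequences = {s. diverging_product s s}"

definition gromov_rel :: "((nat \<Rightarrow> 'a::metric_space) \<times> (nat \<Rightarrow> 'a)) set" where
  "gromov_rel = {(s, t). s \<in> gromov_sequences \<and> t \<in> gromov_sequences \<and> diverging_product s t}"

definition gromov_boundary :: "(nat \<Rightarrow> 'a::metric_space) set set" where
  "gromov_boundary = gromov_sequences // gromov_rel"


section \<open>The topology of the space together with its boundary\<close>

type_synonym 'a bordification = "'a + (nat \<Rightarrow> 'a) set"

definition bordification :: "'a::metric_space bordification set" where
  "bordification = range Inl \<union> Inr ` gromov_boundary"

definition represents :: "(nat \<Rightarrow> 'a::metric_space) \<Rightarrow> 'a bordification \<Rightarrow> bool" where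
  "represents s p = (case p of Inl y \<Rightarrow> s \<longlonglongrightarrow> y | Inr \<xi> \<Rightarrow> s \<in> \<xi>)"

definition extended_product ::
    "'a::metric_space \<Rightarrow> 'a bordification \<Rightarrow> 'a bordification \<Rightarrow> ereal" where
  "extended_product w p q =
     Sup {Liminf (sequentially \<times>\<^sub>F sequentially) (\<lambda>(i, j). ereal (gromov_product w (s i) (t j)))
          | s t. represents s p \<and> represents t q}"

text \<open>
  Neighbourhoods of a point of the space are the metric ones; the sets of points whose extended
  Gromov product with a boundary point \<open>\<xi>\<close> exceeds \<open>R\<close> form a neighbourhood base at \<open>\<xi>\<close>.
\<close>

definition bordification_open :: "'a::metric_space bordification set \<Rightarrow> bool" where
  "bordification_open U \<longleftrightarrow> U \<subseteq> bordification \<and> open (Inl -` U) \<and>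
     (\<forall>\<xi> w. Inr \<xi> \<in> U \<longrightarrow>
        (\<exists>R::real. {p \<in> bordification. extended_product w p (Inr \<xi>) > ereal R} \<subseteq> U))"

lemma istopology_bordification: "istopology (bordification_open :: 'a::metric_space bordification set \<Rightarrow> bool)"
  unfolding istopology_def
proof (intro conjI allI impI)
  fix S T :: "'a bordification set"
  assume S: "bordification_open S" and T: "bordification_open T"
  show "bordification_open (S \<inter> T)"
    unfolding bordification_open_def
  proof (intro conjI allI impI)
    show "S \<inter> T \<subseteq> bordification" "open (Inl -` (S \<inter> T))"
      using S T by (auto simp: bordification_open_def)
    fix \<xi> w assume "Inr \<xi> \<in> S \<inter> T"
    then obtain R1 R2 :: real
      where "{p \<in> bordification. extended_product w p (Inr \<xi>) > ereal R1} \<subseteq> S"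
        and "{p \<in> bordification. extended_product w p (Inr \<xi>) > ereal R2} \<subseteq> T"
      using S T unfolding bordification_open_def by blast
    moreover have "ereal R1 \<le> ereal (max R1 R2)" "ereal R2 \<le> ereal (max R1 R2)"
      by simp_all
    ultimately have
      "{p \<in> bordification. extended_product w p (Inr \<xi>) > ereal (max R1 R2)} \<subseteq> S \<inter> T"
      by (blast intro: le_less_trans)
    then show "\<exists>R::real. {p \<in> bordification. extended_product w p (Inr \<xi>) > ereal R} \<subseteq> S \<inter> T"
      by blast
  qed
next
  fix \<K> :: "'a bordification set set"
  assume K: "\<forall>K\<in>\<K>. bordification_open K"
  show "bordification_open (\<Union>\<K>)"
    unfolding bordification_open_def
  proof (intro conjI allI impI)
    show "\<Union>\<K> \<subseteq> bordification"
      using K by (auto simp: bordification_open_def)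
    show "open (Inl -` (\<Union>\<K>))"
      using K by (auto simp: bordification_open_def vimage_Union)
    fix \<xi> w assume "Inr \<xi> \<in> \<Union>\<K>"
    then obtain K0 where K0: "K0 \<in> \<K>" "Inr \<xi> \<in> K0" by blast
    with K obtain R :: real
      where "{p \<in> bordification. extended_product w p (Inr \<xi>) > ereal R} \<subseteq> K0"
      unfolding bordification_open_def by blast
    with K0 show "\<exists>R::real. {p \<in> bordification. extended_product w p (Inr \<xi>) > ereal R} \<subseteq> \<Union>\<K>"
      by blast
  qed
qed

definition bordification_topology :: "'a::metric_space bordification topology" where
  "bordification_topology = topology bordification_open"

lemma openin_bordification_topology [simp]:
  "openin bordification_topology = bordification_open"
  by (simp add: bordification_topology_def istopology_bordification)

lemma topspace_bordification_topology [simp]: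
  "topspace bordification_topology = bordification"
proof -
  have "bordification_open bordification"
    by (auto simp: bordification_open_def bordification_def vimage_def)
  moreover have "U \<subseteq> bordification" if "bordification_open U" for U :: "'a bordification set"
    using that by (simp add: bordification_open_def)
  ultimately show ?thesis
    unfolding topspace_def by auto
qed


section \<open>Discrete groups of isometries\<close>

definition isom_group :: "('a::metric_space \<Rightarrow> 'a) monoid" where
  "isom_group =
     \<lparr>carrier = {f. bij f \<and> (\<forall>x y. dist (f x) (f y) = dist x y)}, mult = (\<circ>), one = id\<rparr>"

lemma group_isom_group: "group (isom_group :: ('a::metric_space \<Rightarrow> 'a) monoid)"
proof (rule groupI)
  fix f :: "'a \<Rightarrow> 'a"
  assume "f \<in> carrier isom_group"
  then have f: "bij f" "\<And>x y. dist (f x) (f y) = dist x y"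
    by (auto simp: isom_group_def)
  have "dist (inv_into UNIV f x) (inv_into UNIV f y) = dist x y" for x y
    using f(2)[of "inv_into UNIV f x" "inv_into UNIV f y"] f(1)
    by (simp add: bij_is_surj surj_f_inv_f)
  then have "inv_into UNIV f \<in> carrier isom_group"
    using f(1) by (simp add: isom_group_def bij_imp_bij_inv)
  moreover have "inv_into UNIV f \<circ> f = id"
    using f(1) by (simp add: bij_is_inj)
  ultimately show "\<exists>g\<in>carrier isom_group. g \<otimes>\<^bsub>isom_group\<^esub> f = \<one>\<^bsub>isom_group\<^esub>"
    by (auto simp: isom_group_def)
qed (auto simp: isom_group_def bij_comp comp_assoc)

definition discrete_isometries :: "('a::metric_space \<Rightarrow> 'a) set \<Rightarrow> bool" where
  "discrete_isometries \<Gamma> \<longleftrightarrow> (\<forall>x. \<forall>R\<ge>0. finite {g \<in> \<Gamma>. dist x (g x) \<le> R})"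

definition orbit :: "('a \<Rightarrow> 'a) set \<Rightarrow> 'a \<Rightarrow> 'a set" where
  "orbit \<Gamma> x = (\<lambda>g. g x) ` \<Gamma>"

text \<open>All orbits of a group of isometries have the same accumulation points in the boundary.\<close>

definition limit_set :: "('a::metric_space \<Rightarrow> 'a) set \<Rightarrow> (nat \<Rightarrow> 'a) set set" where
  "limit_set \<Gamma> = {\<xi> \<in> gromov_boundary.
     \<exists>x. Inr \<xi> \<in> bordification_topology derived_set_of (Inl ` orbit \<Gamma> x)}"

definition non_elementary :: "('a::metric_space \<Rightarrow> 'a) set \<Rightarrow> bool" where
  "non_elementary \<Gamma> \<longleftrightarrow> infinite (limit_set \<Gamma>) \<or> card (limit_set \<Gamma>) > 2"

definition orbit_growth :: "('a::metric_space \<Rightarrow> 'a) set \<Rightarrow> 'a \<Rightarrow> real \<Rightarrow> ereal" where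
  "orbit_growth \<Gamma> x T = ereal (1 / T * ln (real (card (orbit \<Gamma> x \<inter> ball x T))))"

text \<open>
  For discrete groups of isometries the upper limit does not depend on the base point, so that
  the description below is well defined.
\<close>

definition critical_exponent :: "('a::metric_space \<Rightarrow> 'a) set \<Rightarrow> ereal" where
  "critical_exponent \<Gamma> = (THE h. \<forall>x. Limsup at_top (orbit_growth \<Gamma> x) = h)"

end

theory Submission
  imports Defs "HOL-Real_Asymp.Real_Asymp"
begin

text \<open>
  The number of group elements is almost supermultiplicative. Suppose a finite set \<open>F\<close> of group
  elements is such that for all points \<open>u\<close>, \<open>v\<close> some \<open>f \<in> F\<close> makes the Gromov product of \<open>u\<close> and
  \<open>f v\<close> at \<open>x\<close> bounded. Given \<open>g\<close>, \<open>h\<close>, taking \<open>u = g\<^sup>-\<^sup>1 x\<close> and \<open>v = h x\<close> yields a product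
  \<open>g f h\<close> whose geodesic from \<open>x\<close> passes near \<open>g x\<close>, so it determines \<open>g\<close>, \<open>h\<close> up to boundedly many
  choices once the distance from \<open>x\<close> to \<open>g x\<close> is known up to 1. If \<open>a n\<close> counts the elements
  with displacement in \<open>[n, n + 1)\<close> and \<open>V\<close> counts those in balls, then
  \<open>a n * V S \<le> K * V (S + n + c)\<close>, and iterating in \<open>S\<close> bounds every \<open>a n\<close>, hence the upper
  growth rate of \<open>V\<close>, by the lower one.

  If there is no such \<open>F\<close>, then the group fixes a point at infinity. Among three orbit points far
  away in different directions there is then a \<open>g x\<close> that is not in the direction of that point. For
  each \<open>h\<close> the elements \<open>g\<^sup>m h g\<^sup>-\<^sup>m\<close> displace \<open>x\<close> by a bounded amount, so by discreteness two of them
  agree and \<open>h\<close> commutes with a power of \<open>g\<close>. Hence the whole orbit stays near the axis of \<open>g\<close>,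
  which has only two ends.
\<close>

section \<open>Exponential growth rates\<close>

text \<open>The factor \<open>K\<close> adds a constant to the logarithm and the shift
  \<open>d\<close> changes \<open>T\<close> by a bounded amount; both vanish after division by
  \<open>T\<close>. This gives independence of the base point.\<close>

lemma Limsup_ln_growth_le:
  fixes f g :: "real \<Rightarrow> real"
  assumes f: "\<And>T. T > 0 \<Longrightarrow> f T \<ge> 1" and g: "\<And>T. T > 0 \<Longrightarrow> g T \<ge> 1"
    and K: "K > 0" and d: "d \<ge> 0" and le: "\<And>T. T > 0 \<Longrightarrow> f T \<le> K * g (T + d)"
  shows "Limsup at_top (\<lambda>T. ereal (1 / T * ln (f T))) \<le> Limsup at_top (\<lambda>T. ereal (1 / T * ln (g T)))"
    (is "?L \<le> ?R")
proof (rule ereal_le_real)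
  fix l :: real
  assume l: "?R \<le> ereal l"
  show "?L \<le> ereal l"
  proof (rule ereal_le_epsilon2)
    fix e :: real
    assume e: "e > 0"
    have "?R < ereal (l + e)"
      using l e by (metis ereal_less_eq(3) less_add_same_cancel1 linorder_not_le order_trans)
    then have ev: "\<forall>\<^sub>F T in at_top. ereal (1 / T * ln (g T)) < ereal (l + e)"
      by (rule Limsup_lessD)
    have "filterlim (\<lambda>T::real. T + d) at_top at_top"
      by real_asymp
    then have "\<forall>\<^sub>F T in at_top. ereal (1 / (T + d) * ln (g (T + d))) < ereal (l + e)"
      using ev by (rule eventually_compose_filterlim[rotated])
    moreover have "\<forall>\<^sub>F T::real in at_top. T > 0"
      by (rule eventually_gt_at_top)
    ultimately have "\<forall>\<^sub>F T in at_top.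
        ereal (1 / T * ln (f T)) \<le> ereal (ln K / T + (T + d) / T * (l + e))"
    proof eventually_elim
      case (elim T)
      have "ln (f T) \<le> ln (K * g (T + d))"
        using f[of T] le[of T] elim by (intro ln_mono) auto
      also have "\<dots> = ln K + ln (g (T + d))"
        using K g[of "T + d"] d elim by (intro ln_mult_pos) auto
      also have "ln (g (T + d)) \<le> (T + d) * (l + e)"
        using elim d by (simp add: field_simps)
      finally have "ln (f T) \<le> ln K + (T + d) * (l + e)"
        by simp
      then show ?case
        using elim by (simp add: divide_simps)
    qed
    then have "?L \<le> Limsup at_top (\<lambda>T. ereal (ln K / T + (T + d) / T * (l + e)))"
      by (rule Limsup_mono)
    also have "((\<lambda>T. ln K / T + (T + d) / T * (l + e)) \<longlongrightarrow> l + e) at_top"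
      by real_asymp
    then have "Limsup at_top (\<lambda>T. ereal (ln K / T + (T + d) / T * (l + e))) = ereal (l + e)"
      by (intro lim_imp_Limsup) auto
    finally show "?L \<le> ereal l + ereal e"
      by simp
  qed
qed

text \<open>Iterating \<open>sup\<close> with \<open>n\<close> fixed makes \<open>f\<close> grow at
  least like powers of \<open>a n / K\<close>. So a lower growth rate of at most \<open>l\<close>
  forces \<open>a n \<le> K * exp (l * (n + c))\<close>, and by \<open>sum\<close> the value
  \<open>f T\<close> is at most about \<open>T\<close> such terms.\<close>

lemma Limsup_le_Liminf_supermultiplicative:
  fixes f :: "real \<Rightarrow> real" and a :: "nat \<Rightarrow> real"
  assumes f: "\<And>T. T > 0 \<Longrightarrow> f T \<ge> 1" and mono: "\<And>S T. S \<le> T \<Longrightarrow> f S \<le> f T"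
    and a: "\<And>n. a n \<ge> 0" and K: "K > 0" and c: "c > 0"
    and sup: "\<And>n S. S > 0 \<Longrightarrow> a n * f S \<le> K * f (S + n + c)"
    and sum: "\<And>T. T > 0 \<Longrightarrow> f T \<le> (\<Sum>n\<le>nat \<lfloor>T\<rfloor>. a n)"
  shows "Limsup at_top (\<lambda>T. ereal (1 / T * ln (f T))) \<le> Liminf at_top (\<lambda>T. ereal (1 / T * ln (f T)))"
    (is "?L \<le> ?R")
proof (rule ereal_le_real)
  fix l :: real
  assume l: "?R \<le> ereal l"
  have "0 \<le> ?R"
  proof (rule Liminf_bounded)
    show "\<forall>\<^sub>F T in at_top. 0 \<le> ereal (1 / T * ln (f T))"
      using eventually_gt_at_top[of 0] by eventually_elim (use f in auto)
  qed
  then have l0: "l \<ge> 0"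
    using l by (metis ereal_less_eq(5) order_trans)
  \<comment> \<open>The iteration starts at radius 1 because \<open>sup\<close> needs a positive
    radius.\<close>
  have iter: "(a n / K) ^ j \<le> f (1 + j * (n + c))" for n j :: nat
  proof (induction j)
    case 0
    then show ?case using f[of 1] by simp
  next
    case (Suc j)
    have pos: "1 + j * (n + c) > 0"
      using c by (simp add: add_pos_nonneg)
    have "(a n / K) ^ Suc j \<le> a n / K * f (1 + j * (n + c))"
      using Suc a[of n] K by (auto intro!: mult_left_mono divide_right_mono)
    also have "\<dots> \<le> f (1 + j * (n + c) + n + c)"
      using sup[OF pos, of n] K by (simp add: field_simps)
    also have "1 + j * (n + c) + n + c = 1 + Suc j * (n + c)"
      by (simp add: algebra_simps)
    finally show ?case .
  qed
  \<comment> \<open>Otherwise \<open>iter\<close> gives a rate above \<open>l\<close> along the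
    radii \<open>1 + j * (n + c)\<close>, and \<open>mono\<close> extends it to all large
    \<open>T\<close>, against the choice of \<open>l\<close>.\<close>
  have bound: "a n \<le> K * exp (l * (n + c))" for n
  proof (rule ccontr)
    assume "\<not> ?thesis"
    then have q: "exp (l * (n + c)) < a n / K" (is "_ < ?q")
      using K by (simp add: field_simps)
    have m: "n + c > 0"
      using c by simp
    have q1: "?q > 1"
      using q l0 m by (meson le_less_trans mult_nonneg_nonneg less_imp_le one_le_exp_iff)
    have "exp (l * (n + c)) < exp (ln ?q)"
      using q q1 by simp
    then have lt: "l < ln ?q / (n + c)"
      using m by (simp add: field_simps)
    have "\<forall>\<^sub>F T in at_top. ereal (((T - 1) / (n + c) - 1) * ln ?q / T) \<le> ereal (1 / T * ln (f T))"
      using eventually_gt_at_top[of 1]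
    proof eventually_elim
      case (elim T)
      \<comment> \<open>This is the number of full steps of length \<open>n + c\<close> between 1
        and \<open>T\<close>.\<close>
      define j where "j = nat \<lfloor>(T - 1) / (n + c)\<rfloor>"
      have nonneg: "(T - 1) / (n + c) \<ge> 0"
        using elim m by simp
      have j: "j \<le> (T - 1) / (n + c)" "(T - 1) / (n + c) - 1 \<le> j"
        unfolding j_def using nonneg by linarith+
      have "1 + j * (n + c) \<le> T"
        using j(1) m by (simp add: field_simps)
      then have "?q ^ j \<le> f T"
        using iter[of n j] mono by (meson order_trans)
      then have "ln (?q ^ j) \<le> ln (f T)"
        using q1 by (intro ln_mono) auto
      then have "j * ln ?q \<le> ln (f T)"
        using q1 by (simp add: ln_realpow)
      moreover have "((T - 1) / (n + c) - 1) * ln ?q \<le> j * ln ?q"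
        using j(2) q1 by (intro mult_right_mono) auto
      ultimately have "((T - 1) / (n + c) - 1) * ln ?q \<le> ln (f T)"
        by linarith
      then show ?case
        using elim by (simp add: divide_right_mono)
    qed
    then have "Liminf at_top (\<lambda>T. ereal (((T - 1) / (n + c) - 1) * ln ?q / T)) \<le> ?R"
      by (rule Liminf_mono)
    moreover have "((\<lambda>T. ((T - 1) / (n + c) - 1) * ln ?q / T) \<longlongrightarrow> ln ?q / (n + c)) at_top"
    proof -
      have "((\<lambda>T. ((T - 1) / m - 1) * b / T) \<longlongrightarrow> b / m) at_top" if "m > 0" for m b :: real
        using that by (real_asymp simp: field_simps)
      from this[OF m] show ?thesis .
    qed
    then have "Liminf at_top (\<lambda>T. ereal (((T - 1) / (n + c) - 1) * ln ?q / T)) = ereal (ln ?q / (n + c))"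
      by (intro lim_imp_Liminf) auto
    ultimately have "ereal (ln ?q / (n + c)) \<le> ereal l"
      using l by (metis order_trans)
    then show False
      using lt by simp
  qed
  have "\<forall>\<^sub>F T in at_top. ereal (1 / T * ln (f T)) \<le> ereal ((ln (T + 1) + ln K + l * (T + c)) / T)"
    using eventually_gt_at_top[of 0]
  proof eventually_elim
    case (elim T)
    have "f T \<le> (\<Sum>n\<le>nat \<lfloor>T\<rfloor>. a n)"
      using sum elim by simp
    also have "\<dots> \<le> (\<Sum>n\<le>nat \<lfloor>T\<rfloor>. K * exp (l * (T + c)))"
    proof (rule sum_mono)
      fix n assume "n \<in> {..nat \<lfloor>T\<rfloor>}"
      then have "real n \<le> T"
        using elim by (simp add: le_nat_floor le_nat_iff le_floor_iff)
      then have "l * (n + c) \<le> l * (T + c)"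
        using l0 by (intro mult_left_mono) auto
      then show "a n \<le> K * exp (l * (T + c))"
        using bound[of n] K by (meson exp_le_cancel_iff mult_left_mono less_imp_le order_trans)
    qed
    also have "\<dots> = (real (nat \<lfloor>T\<rfloor>) + 1) * (K * exp (l * (T + c)))"
      by simp
    also have "\<dots> \<le> (T + 1) * (K * exp (l * (T + c)))"
      using elim K by (intro mult_right_mono) auto
    finally have "ln (f T) \<le> ln ((T + 1) * (K * exp (l * (T + c))))"
      using f[of T] elim by (intro ln_mono) auto
    also have "\<dots> = ln (T + 1) + ln K + l * (T + c)"
      using elim K by (simp add: ln_mult_pos)
    finally show ?case
      using elim by (simp add: divide_right_mono)
  qed
  then have "?L \<le> Limsup at_top (\<lambda>T. ereal ((ln (T + 1) + ln K + l * (T + c)) / T))"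
    by (rule Limsup_mono)
  also have "((\<lambda>T. (ln (T + 1) + ln K + l * (T + c)) / T) \<longlongrightarrow> l) at_top"
    by real_asymp
  then have "Limsup at_top (\<lambda>T. ereal ((ln (T + 1) + ln K + l * (T + c)) / T)) = ereal l"
    by (intro lim_imp_Limsup) auto
  finally show "?L \<le> ereal l" .
qed

section \<open>Gromov products\<close>

lemma gromov_product_commute: "gromov_product w y z = gromov_product w z y"
  by (simp add: gromov_product_def dist_commute)

lemma gromov_product_nonneg: "gromov_product w y z \<ge> 0"
  using dist_triangle[of y z w] by (simp add: gromov_product_def dist_commute)

lemma gromov_product_le_dist: "gromov_product w y z \<le> dist w y"
  using dist_triangle[of w z y] by (simp add: gromov_product_def)

text \<open>In the comparison tripod the two products are the distances from \<open>w\<close> and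
  from \<open>y\<close> to the branch point.\<close>

lemma gromov_product_swap_base: "gromov_product w y z + gromov_product y w z = dist w y"
  by (simp add: gromov_product_def dist_commute field_simps)

lemma dist_eq_gromov_product: "dist y z = dist w y + dist w z - 2 * gromov_product w y z"
  by (simp add: gromov_product_def field_simps)

lemma gromov_product_base_lipschitz: "gromov_product w y z \<le> gromov_product w' y z + dist w w'"
  using dist_triangle[of w y w'] dist_triangle[of w z w']
  by (simp add: gromov_product_def field_simps)

lemma gromov_product_lipschitz: "gromov_product w y z \<le> gromov_product w y' z + dist y y'"
  using dist_triangle[of w y y'] dist_triangle[of y' z y] dist_commute[of y y']
  by (simp add: gromov_product_def field_simps)

lemma gromov_product_ge_dist_diff: "gromov_product w y z \<ge> dist w z - dist y z"
  using dist_triangle[of w z y] by (simp add: gromov_product_def)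

lemma hyperbolic_space_nonneg: "hyperbolic_space TYPE('a::metric_space) \<delta> \<Longrightarrow> \<delta> \<ge> 0"
  by (simp add: hyperbolic_space_def)

lemma gromov_product_ge:
  assumes "hyperbolic_space TYPE('a::metric_space) \<delta>"
    and "c \<le> gromov_product w x y" "c \<le> gromov_product w y (z :: 'a)"
  shows "c - \<delta> \<le> gromov_product w x z"
proof -
  have "gromov_product w x z \<ge> min (gromov_product w x y) (gromov_product w y z) - \<delta>"
    using assms(1) unfolding hyperbolic_space_def by blast
  then show ?thesis using assms(2,3) by linarith
qed

text \<open>The product of \<open>y\<close> and \<open>z\<close> is too large to be the minimum in
  the hyperbolic inequality, so the other product must be small.\<close>

lemma gromov_product_le:
  assumes "hyperbolic_space TYPE('a::metric_space) \<delta>"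
    and "gromov_product w x z \<le> c" "c + \<delta> < gromov_product w y (z :: 'a)"
  shows "gromov_product w x y \<le> c + \<delta>"
proof -
  have "gromov_product w x z \<ge> min (gromov_product w x y) (gromov_product w y z) - \<delta>"
    using assms(1) unfolding hyperbolic_space_def by blast
  then show ?thesis using assms(2,3) by linarith
qed

section \<open>Discrete groups of isometries fixing a point at infinity\<close>

locale isometry_group =
  fixes \<Gamma> :: "('a::metric_space \<Rightarrow> 'a) set"
  assumes subgroup: "subgroup \<Gamma> isom_group"
begin

lemma bij: "g \<in> \<Gamma> \<Longrightarrow> bij g"
  and dist_image: "g \<in> \<Gamma> \<Longrightarrow> dist (g y) (g z) = dist y z"
  using subgroup.subset[OF subgroup] by (auto simp: isom_group_def)

lemma id_mem: "id \<in> \<Gamma>"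
  using subgroup.one_closed[OF subgroup] by (simp add: isom_group_def)

lemma comp_mem: "g \<in> \<Gamma> \<Longrightarrow> h \<in> \<Gamma> \<Longrightarrow> g \<circ> h \<in> \<Gamma>"
  using subgroup.m_closed[OF subgroup] by (simp add: isom_group_def)

lemma funpow_mem: "g \<in> \<Gamma> \<Longrightarrow> g ^^ n \<in> \<Gamma>"
  by (induction n) (auto simp: comp_mem id_mem[unfolded id_def] id_def)

lemma apply_inv [simp]: "g \<in> \<Gamma> \<Longrightarrow> g (inv_into UNIV g y) = y"
  by (simp add: bij bij_is_surj surj_f_inv_f)

lemma inv_apply [simp]: "g \<in> \<Gamma> \<Longrightarrow> inv_into UNIV g (g y) = y"
  by (simp add: bij bij_is_inj)

text \<open>Subgroups are closed under \<open>m_inv\<close>; uniqueness of left inverses identifies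
  it with the inverse function.\<close>

lemma inv_mem:
  assumes "g \<in> \<Gamma>"
  shows "inv_into UNIV g \<in> \<Gamma>"
proof -
  have dist_inv: "dist (inv_into UNIV g y) (inv_into UNIV g z) = dist y z" for y z
    using dist_image[OF assms, of "inv_into UNIV g y" "inv_into UNIV g z"] assms by simp
  have carrier: "inv_into UNIV g \<in> carrier isom_group"
    using bij[OF assms] dist_inv by (simp add: isom_group_def bij_imp_bij_inv)
  have "m_inv isom_group g = inv_into UNIV g"
  proof (rule group.inv_equality[OF group_isom_group])
    show "inv_into UNIV g \<otimes>\<^bsub>isom_group\<^esub> g = \<one>\<^bsub>isom_group\<^esub>"
      using assms by (auto simp: isom_group_def)
    show "g \<in> carrier isom_group"
      using subgroup.subset[OF subgroup] assms by blast
  qed (rule carrier)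
  then show ?thesis
    using subgroup.m_inv_closed[OF subgroup assms] by simp
qed

lemma dist_inv_left:
  assumes "g \<in> \<Gamma>"
  shows "dist (inv_into UNIV g y) z = dist y (g z)"
  using dist_image[OF assms, of "inv_into UNIV g y" z] assms by simp

lemma dist_inv: "g \<in> \<Gamma> \<Longrightarrow> dist x (inv_into UNIV g x) = dist x (g x)"
  by (metis dist_inv_left dist_commute)

lemma gromov_product_image:
  "g \<in> \<Gamma> \<Longrightarrow> gromov_product (g w) (g y) (g z) = gromov_product w y z"
  by (simp add: gromov_product_def dist_image)

lemma gromov_product_inv_left:
  assumes "g \<in> \<Gamma>"
  shows "gromov_product (inv_into UNIV g w) y z = gromov_product w (g y) (g z)"
  using gromov_product_image[OF assms, of "inv_into UNIV g w" y z] assms by simp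

lemma dist_comp_le: "g \<in> \<Gamma> \<Longrightarrow> dist x (g (h x)) \<le> dist x (g x) + dist x (h x)"
  by (metis dist_image dist_triangle)

end

section \<open>Isometries of a hyperbolic space and their axes\<close>

locale discrete_hyperbolic_group = isometry_group \<Gamma>
  for \<Gamma> :: "('a::metric_space \<Rightarrow> 'a) set" +
  fixes \<delta> :: real
  assumes hyperbolic: "hyperbolic_space TYPE('a) \<delta>"
    and discrete: "discrete_isometries \<Gamma>"
begin

lemma delta_nonneg: "\<delta> \<ge> 0"
  using hyperbolic by (rule hyperbolic_space_nonneg)

lemmas product_ge = gromov_product_ge[OF hyperbolic]
lemmas product_le = gromov_product_le[OF hyperbolic]

lemma finite_displacement: "finite {g \<in> \<Gamma>. dist x (g x) \<le> R}"
proof (cases "R \<ge> 0")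
  case False
  then have "{g \<in> \<Gamma>. dist x (g x) \<le> R} = {}"
    by (auto simp: not_le intro: less_le_trans[OF _ zero_le_dist])
  then show ?thesis by (simp only: finite.emptyI)
qed (use discrete in \<open>auto simp: discrete_isometries_def\<close>)

text \<open>From \<open>x\<close> the point \<open>a v\<close> lies in the direction of
  \<open>v\<close>, hence away from \<open>a x\<close>. Applying the inverse of \<open>a\<close>
  makes a product at \<open>inv_into UNIV a x\<close> small, and swapping base points makes the one
  at \<open>x\<close> large: \<open>a\<close> pushes away from \<open>v\<close>.\<close>

lemma product_inv_ge:
  assumes a: "a \<in> \<Gamma>" and c: "gromov_product x (a x) v \<le> c"
    and v: "c + \<delta> < gromov_product x v (a v)"
  shows "gromov_product x (inv_into UNIV a x) v \<ge> dist x (a x) - c - \<delta>"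
proof -
  have "gromov_product x (a x) (a v) \<le> c + \<delta>"
    using product_le[OF c] v by (simp add: gromov_product_commute)
  then have "gromov_product (inv_into UNIV a x) x v \<le> c + \<delta>"
    using a by (simp add: gromov_product_inv_left)
  then show ?thesis
    using gromov_product_swap_base[of x "inv_into UNIV a x" v] dist_inv[OF a, of x] by linarith
qed

text \<open>By \<open>c\<close>, \<open>x\<close> lies almost between its images under the inverse
  of \<open>a\<close> and under \<open>a\<close>, so \<open>h x\<close> lies almost between the
  \<open>h\<close>-images of these two points. As \<open>h\<close> commutes with \<open>a\<close>,
  it moves them only by \<open>dist x (h x)\<close>, so \<open>h x\<close> lies almost between the
  points themselves. Hence seen from \<open>h x\<close> the point \<open>x\<close> cannot be in the
  direction of both.\<close>

lemma near_axis:
  assumes a: "a \<in> \<Gamma>" and h: "h \<in> \<Gamma>" and comm: "a \<circ> h = h \<circ> a"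
    and c: "gromov_product x (a x) (inv_into UNIV a x) \<le> c"
    and large: "dist x (a x) > 2 * dist x (h x) + c + 2 * \<delta>"
  shows "gromov_product x (a x) (h x) \<ge> dist x (h x) - c - 3 * \<delta> \<or>
    gromov_product x (inv_into UNIV a x) (h x) \<ge> dist x (h x) - c - 3 * \<delta>"
proof -
  let ?b = "inv_into UNIV a"
  have ah: "a (h y) = h (a y)" for y
    using comm by (metis comp_apply)
  have bh: "?b (h y) = h (?b y)" for y
    using ah[of "?b y"] a by (metis apply_inv inv_apply)
  have b: "?b \<in> \<Gamma>"
    using a by (rule inv_mem)
  have far: "gromov_product (h x) (h (f x)) (f x) \<ge> dist x (f x) - 2 * dist x (h x)"
    if f: "f \<in> \<Gamma>" and fh: "f (h x) = h (f x)" for f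
  proof -
    have "dist x (f x) \<le> dist x (h x) + dist (h x) (f x)"
      by (rule dist_triangle)
    moreover have "dist (h (f x)) (f x) = dist x (h x)"
      using dist_image[OF f, of "h x" x] fh by (simp add: dist_commute)
    ultimately show ?thesis
      using gromov_product_ge_dist_diff[of "h x" "f x" "h (f x)"] by linarith
  qed
  have 1: "gromov_product (h x) (h (a x)) (h (?b x)) \<le> c"
    using c h by (simp add: gromov_product_image)
  \<comment> \<open>The two \<open>h\<close>-images are replaced by the original points one at a
    time, each at the cost of one \<delta>.\<close>
  have 2: "gromov_product (h x) (h (a x)) (?b x) \<le> c + \<delta>"
    using far[OF b bh] dist_inv[OF a, of x] large delta_nonneg
    by - (rule product_le[OF 1], simp add: gromov_product_commute)
  have "gromov_product (h x) (?b x) (a x) \<le> c + \<delta> + \<delta>"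
    using far[OF a ah] large delta_nonneg 2
    by - (rule product_le[of "h x" "?b x" "h (a x)" "c + \<delta>" "a x"], simp_all add: gromov_product_commute)
  then have 3: "gromov_product (h x) (a x) (?b x) \<le> c + 2 * \<delta>"
    by (simp add: gromov_product_commute)
  have swap: "gromov_product x y (h x) = dist x (h x) - gromov_product (h x) x y" for y
    using gromov_product_swap_base[of x "h x" y] by (simp add: gromov_product_commute)
  show ?thesis
  proof (rule ccontr)
    assume "\<not> ?thesis"
    then have "gromov_product (h x) x (a x) > c + 3 * \<delta>" "gromov_product (h x) x (?b x) > c + 3 * \<delta>"
      unfolding swap by linarith+
    then show False
      using product_le[OF 3, of x] by (simp add: gromov_product_commute)
  qed
qed

end

section \<open>Groups fixing a point at infinity\<close>

text \<open>
  The filter \<open>F\<close> stands for a point at infinity, and \<open>fixed\<close> says that the group fixes it.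
\<close>

locale fixed_end = discrete_hyperbolic_group \<Gamma> \<delta>
  for \<Gamma> :: "('a::metric_space \<Rightarrow> 'a) set" and \<delta> +
  fixes F :: "'a filter" and x :: 'a
  assumes nontrivial: "F \<noteq> bot"
    and fixed: "f \<in> \<Gamma> \<Longrightarrow> filterlim (\<lambda>v. gromov_product x v (f v)) at_top F"
begin

lemma eventually_product_gt: "f \<in> \<Gamma> \<Longrightarrow> \<forall>\<^sub>F v in F. gromov_product x v (f v) > R"
  using fixed by (simp add: filterlim_at_top_dense)

lemma eventually_obtain:
  assumes "\<forall>\<^sub>F v in F. P v"
  obtains v where "P v"
  using assms nontrivial eventually_happens by blast

text \<open>A ping-pong argument: \<open>g\<close> sends points away from the direction of
  \<open>inv_into UNIV g x\<close> into the direction of \<open>g x\<close>, while the fixed end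
  lies in the former direction. The second bound does not mention \<open>v\<close>, but is derived
  through it.\<close>

lemma forward_orbit:
  assumes g: "g \<in> \<Gamma>" and M: "\<forall>\<^sub>F v in F. gromov_product x (g x) v \<le> M" "M \<ge> 0"
    and large: "dist x (g x) > 2 * M + 4 * \<delta>"
  shows "\<forall>\<^sub>F v in F. gromov_product x ((g ^^ m) x) v \<le> M + \<delta> \<and>
    gromov_product x ((g ^^ m) x) (inv_into UNIV g x) \<le> M + 2 * \<delta>"
proof (induction m)
  case 0
  have "gromov_product x x y = 0" for y
    by (simp add: gromov_product_def)
  then show ?case
    using M(2) delta_nonneg by simp
next
  case (Suc m)
  show ?case
    using Suc M(1) eventually_product_gt[OF g, of "dist x (g x)"]
  proof eventually_elim
    case (elim v)
    have "gromov_product x (inv_into UNIV g x) v \<ge> dist x (g x) - M - \<delta>"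
      using g elim large M(2) delta_nonneg by (intro product_inv_ge) auto
    then have behind: "gromov_product x (inv_into UNIV g x) v > M + 2 * \<delta>"
      using large delta_nonneg by linarith
    \<comment> \<open>This is the image under \<open>g\<close> of the second bound for
      \<open>m\<close>; swapping base points then puts the next iterate in the direction of
      \<open>g x\<close>.\<close>
    have "gromov_product (g x) x ((g ^^ Suc m) x) \<le> M + 2 * \<delta>"
      using elim(1) gromov_product_image[OF g, of x "inv_into UNIV g x" "(g ^^ m) x"] g
      by (simp add: gromov_product_commute)
    then have "gromov_product x (g x) ((g ^^ Suc m) x) > M + \<delta>"
      using gromov_product_swap_base[of x "g x" "(g ^^ Suc m) x"] large delta_nonneg by linarith
    then have "gromov_product x v ((g ^^ Suc m) x) \<le> M + \<delta>"
      using elim(2) by - (rule product_le[of x v "g x"], simp_all add: gromov_product_commute)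
    moreover from this have "gromov_product x ((g ^^ Suc m) x) (inv_into UNIV g x) \<le> M + \<delta> + \<delta>"
      using behind by - (rule product_le[of x _ v], simp_all add: gromov_product_commute)
    ultimately show ?case
      by (simp add: gromov_product_commute)
  qed
qed

text \<open>By the second bound of \<open>forward_orbit\<close> each step loses at most
  \<open>2 * (M + 2 * \<delta>)\<close> of the displacement of \<open>g\<close>, so it gains at
  least 1.\<close>

lemma dist_funpow_ge:
  assumes g: "g \<in> \<Gamma>" and M: "\<forall>\<^sub>F v in F. gromov_product x (g x) v \<le> M" "M \<ge> 0"
    and large: "dist x (g x) \<ge> 2 * M + 4 * \<delta> + 1"
  shows "dist x ((g ^^ m) x) \<ge> m"
proof (induction m)
  case (Suc m)
  have "gromov_product x ((g ^^ m) x) (inv_into UNIV g x) \<le> M + 2 * \<delta>"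
    using forward_orbit[OF g M, of m] large by (auto elim: eventually_obtain)
  moreover have "dist x ((g ^^ Suc m) x) = dist ((g ^^ m) x) (inv_into UNIV g x)"
    using dist_inv_left[OF g, of x "(g ^^ m) x"] by (simp add: dist_commute)
  ultimately show ?case
    using Suc large dist_inv[OF g, of x] dist_eq_gromov_product[of "(g ^^ m) x" "inv_into UNIV g x" x]
    by simp
qed simp

text \<open>By \<open>product_inv_ge\<close> the image of \<open>x\<close> under the inverse lies
  towards the fixed end, whereas \<open>a x\<close> does not.\<close>

lemma product_inverse_le:
  assumes a: "a \<in> \<Gamma>" and c: "\<forall>\<^sub>F v in F. gromov_product x (a x) v \<le> c"
    and large: "dist x (a x) > 2 * c + 2 * \<delta>"
  shows "gromov_product x (a x) (inv_into UNIV a x) \<le> c + \<delta>"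
proof -
  obtain v where v: "gromov_product x (a x) v \<le> c" "c + \<delta> < gromov_product x v (a v)"
    using eventually_conj[OF c eventually_product_gt[OF a, of "c + \<delta>"]]
    by (rule eventually_obtain) auto
  have "gromov_product x (inv_into UNIV a x) v \<ge> dist x (a x) - c - \<delta>"
    using a v by (rule product_inv_ge)
  then show ?thesis
    using v(1) large by - (rule product_le[of x _ v], auto)
qed

text \<open>
  Both \<open>a\<^sup>-\<^sup>1 x\<close> and \<open>h (a\<^sup>-\<^sup>1 x)\<close> lie near a ray from \<open>x\<close> to the fixed end, at almost the
  same distance from \<open>x\<close>.
\<close>

lemma dist_conjugate_le:
  assumes a: "a \<in> \<Gamma>" and h: "h \<in> \<Gamma>" and c: "\<forall>\<^sub>F v in F. gromov_product x (a x) v \<le> c"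
  shows "dist x ((a \<circ> h \<circ> inv_into UNIV a) x) \<le> 3 * dist x (h x) + 2 * c + 6 * \<delta>"
proof -
  \<comment> \<open>This threshold lets one \<open>v\<close> stand for the fixed end in all
    estimates below, for \<open>a\<close> and for \<open>h\<close>.\<close>
  let ?R = "dist x (a x) + \<bar>c\<bar> + \<delta> + dist x (h x)"
  obtain v where v: "gromov_product x (a x) v \<le> c" "?R < gromov_product x v (a v)"
      "?R < gromov_product x v (h v)"
    using eventually_conj[OF c eventually_conj[OF eventually_product_gt[OF a, of ?R] eventually_product_gt[OF h, of ?R]]]
    by (rule eventually_obtain) auto
  define q where "q = inv_into UNIV a x"
  have c0: "c \<ge> 0"
    using v(1) gromov_product_nonneg order_trans by blast
  have q: "dist x q = dist x (a x)"
    unfolding q_def using a by (rule dist_inv)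
  have qv: "gromov_product x q v \<ge> dist x q - c - \<delta>"
    unfolding q using v delta_nonneg zero_le_dist[of x "a x"] zero_le_dist[of x "h x"]
    unfolding q_def by (intro product_inv_ge[OF a]) linarith+
  have "gromov_product (h x) (h q) (h v) \<ge> dist x q - c - \<delta>"
    using qv by (simp add: gromov_product_image[OF h])
  moreover have "gromov_product (h x) (h v) v \<ge> dist x q - c - \<delta>"
    using v(3) gromov_product_base_lipschitz[of x v "h v" "h x"] q c0 delta_nonneg
    by (simp add: gromov_product_commute)
  ultimately have "gromov_product (h x) (h q) v \<ge> dist x q - c - \<delta> - \<delta>"
    by (rule product_ge)
  then have "gromov_product x (h q) v \<ge> dist x q - c - 2 * \<delta> - dist x (h x)"
    using gromov_product_base_lipschitz[of "h x" "h q" v x] by (simp add: dist_commute)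
  moreover have "gromov_product x v q \<ge> dist x q - c - 2 * \<delta> - dist x (h x)"
    using qv delta_nonneg zero_le_dist[of x "h x"] unfolding gromov_product_commute[of x v q]
    by linarith
  ultimately have "gromov_product x (h q) q \<ge> dist x q - c - 2 * \<delta> - dist x (h x) - \<delta>"
    by (rule product_ge)
  moreover have "dist x (h q) \<le> dist x (h x) + dist x q"
    using dist_triangle[of x "h q" "h x"] by (simp add: dist_image[OF h])
  moreover have "dist x ((a \<circ> h \<circ> inv_into UNIV a) x) = dist q (h q)"
    using dist_inv_left[OF a] by (simp add: q_def)
  \<comment> \<open>The distances from \<open>x\<close> to \<open>q\<close> cancel, which makes the
    bound independent of the displacement of \<open>a\<close>.\<close>
  ultimately show ?thesis
    using dist_eq_gromov_product[of "h q" q x] by (simp add: dist_commute)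
qed

text \<open>By discreteness two of the conjugates \<open>g\<^sup>m h g\<^sup>-\<^sup>m\<close> coincide.\<close>

lemma commuting_power:
  assumes g: "g \<in> \<Gamma>" and h: "h \<in> \<Gamma>"
    and c: "\<And>m. \<forall>\<^sub>F v in F. gromov_product x ((g ^^ m) x) v \<le> c"
  obtains p where "p > 0" "(g ^^ p) \<circ> h = h \<circ> (g ^^ p)"
proof -
  \<comment> \<open>As \<open>c\<close> serves all powers of \<open>g\<close>, this one finite set
    contains all conjugates.\<close>
  define S where "S = {f \<in> \<Gamma>. dist x (f x) \<le> 3 * dist x (h x) + 2 * c + 6 * \<delta>}"
  define conj where "conj m = (g ^^ m) \<circ> h \<circ> inv_into UNIV (g ^^ m)" for m
  have "range conj \<subseteq> S"
  proof
    fix f assume "f \<in> range conj"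
    then obtain m where "f = conj m" by blast
    then show "f \<in> S"
      unfolding conj_def S_def
      using dist_conjugate_le[OF funpow_mem[OF g] h c] g h
      by (auto intro!: comp_mem funpow_mem inv_mem)
  qed
  then have "\<not> inj conj"
    using finite_subset[OF _ finite_displacement] finite_imageD[of conj UNIV] unfolding S_def by auto
  then obtain i j where ij: "i < j" "conj i = conj j"
    unfolding inj_def by (metis linorder_neqE_nat)
  define p where "p = j - i"
  have mem: "g ^^ n \<in> \<Gamma>" for n
    using g by (rule funpow_mem)
  have "(g ^^ p) (h y) = h ((g ^^ p) y)" for y
  proof -
    have "(g ^^ j) y = (g ^^ i) ((g ^^ p) y)" for y
      using ij(1) unfolding p_def by (metis comp_apply funpow_add le_add_diff_inverse less_imp_le)
    note j = this
    \<comment> \<open>The equality \<open>conj i = conj j\<close> is evaluated at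
      \<open>(g ^^ j) y\<close>; then the injective \<open>g ^^ i\<close> cancels.\<close>
    have "(g ^^ i) ((g ^^ p) (h y)) = conj j ((g ^^ j) y)"
      using mem[of j] by (simp add: conj_def j[symmetric])
    also have "\<dots> = conj i ((g ^^ i) ((g ^^ p) y))"
      by (simp add: ij(2) j)
    also have "\<dots> = (g ^^ i) (h ((g ^^ p) y))"
      using mem[of i] by (simp add: conj_def)
    finally show ?thesis
      using mem[of i] by (metis inv_apply)
  qed
  then show ?thesis
    using ij(1) by (intro that[of p]) (auto simp: p_def)
qed

end

lemma funpow_commute_power:
  assumes "a \<circ> h = h \<circ> a"
  shows "(a ^^ n) \<circ> h = h \<circ> (a ^^ n)"
proof (induction n)
  case (Suc n)
  then show ?case
    using assms by (simp add: fun_eq_iff)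
qed simp

context fixed_end
begin

text \<open>Finitely many \<open>h\<close> commute with a common power \<open>a\<close> of
  \<open>g\<close>, so \<open>near_axis\<close> applies to all of them with the same two points, the
  images of \<open>x\<close> under \<open>a\<close> and its inverse.\<close>

lemma orbit_near_axis:
  assumes g: "g \<in> \<Gamma>" and M: "\<forall>\<^sub>F v in F. gromov_product x (g x) v \<le> M" "M \<ge> 0"
    and large: "dist x (g x) \<ge> 2 * M + 4 * \<delta> + 1"
    and H: "finite H" "H \<subseteq> \<Gamma>"
  obtains p q where "\<And>h. h \<in> H \<Longrightarrow> gromov_product x p (h x) \<ge> dist x (h x) - M - 5 * \<delta> \<or>
    gromov_product x q (h x) \<ge> dist x (h x) - M - 5 * \<delta>"
proof -
  have c: "\<forall>\<^sub>F v in F. gromov_product x ((g ^^ m) x) v \<le> M + \<delta>" for m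
    using forward_orbit[OF g M, of m] large by (auto elim: eventually_mono)
  have "\<exists>k>0. (g ^^ k) \<circ> h = h \<circ> (g ^^ k)" if "h \<in> H" for h
    using commuting_power[OF g _ c] that H(2) by blast
  then obtain k where k: "\<And>h. h \<in> H \<Longrightarrow> k h > 0 \<and> (g ^^ k h) \<circ> h = h \<circ> (g ^^ k h)"
    by metis
  \<comment> \<open>The product of the exponents \<open>k h\<close> ensures commutation; the factor
    \<open>j\<close> makes the displacement of \<open>a\<close> large enough for
    \<open>near_axis\<close>.\<close>
  define j where "j = nat \<lceil>(\<Sum>h\<in>H. 2 * dist x (h x)) + 2 * M + 4 * \<delta>\<rceil> + 1"
  define N where "N = prod k H * j"
  define a where "a = g ^^ N"
  have a: "a \<in> \<Gamma>"
    unfolding a_def using g by (rule funpow_mem)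
  have "prod k H > 0"
    using k by (intro prod_pos) auto
  then have "j \<le> N"
    by (simp add: N_def)
  moreover have "real j > (\<Sum>h\<in>H. 2 * dist x (h x)) + 2 * M + 4 * \<delta>"
    unfolding j_def by linarith
  ultimately have "real N > (\<Sum>h\<in>H. 2 * dist x (h x)) + 2 * M + 4 * \<delta>"
    by linarith
  then have a_large: "dist x (a x) > (\<Sum>h\<in>H. 2 * dist x (h x)) + 2 * M + 4 * \<delta>"
    using dist_funpow_ge[OF g M large, of N] by (simp add: a_def)
  have "(\<Sum>h\<in>H. 2 * dist x (h x)) \<ge> 0"
    by (simp add: sum_nonneg)
  then have "gromov_product x (a x) (inv_into UNIV a x) \<le> M + \<delta> + \<delta>"
    using a_large by (intro product_inverse_le[OF a]) (use c in \<open>simp_all add: a_def\<close>)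
  then have inverse: "gromov_product x (a x) (inv_into UNIV a x) \<le> M + 2 * \<delta>"
    by simp
  have "gromov_product x (a x) (h x) \<ge> dist x (h x) - (M + 2 * \<delta>) - 3 * \<delta> \<or>
    gromov_product x (inv_into UNIV a x) (h x) \<ge> dist x (h x) - (M + 2 * \<delta>) - 3 * \<delta>" if h: "h \<in> H" for h
  proof (rule near_axis[OF a _ _ inverse])
    show "h \<in> \<Gamma>"
      using h H(2) by blast
    have "k h dvd N"
      unfolding N_def using H(1) h by (simp add: dvd_prodI)
    then obtain n where "N = k h * n" ..
    then have "a = (g ^^ k h) ^^ n"
      by (simp add: a_def funpow_mult)
    then show "a \<circ> h = h \<circ> a"
      using k[OF h] by (simp add: funpow_commute_power)
    have "2 * dist x (h x) \<le> (\<Sum>h\<in>H. 2 * dist x (h x))"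
      using H(1) h by (intro member_le_sum) auto
    then show "dist x (a x) > 2 * dist x (h x) + (M + 2 * \<delta>) + 2 * \<delta>"
      using a_large M(2) by linarith
  qed
  then show ?thesis
    by (intro that[of "a x" "inv_into UNIV a x"]) (simp add: algebra_simps)
qed

end

text \<open>This says that the orbit of \<open>x\<close> accumulates at three or more points at infinity.\<close>

definition three_directions :: "('a::metric_space \<Rightarrow> 'a) set \<Rightarrow> 'a \<Rightarrow> bool" where
  "three_directions \<Gamma> x \<longleftrightarrow> (\<exists>M. \<forall>R. \<exists>h1\<in>\<Gamma>. \<exists>h2\<in>\<Gamma>. \<exists>h3\<in>\<Gamma>.
     dist x (h1 x) \<ge> R \<and> dist x (h2 x) \<ge> R \<and> dist x (h3 x) \<ge> R \<and>
     gromov_product x (h1 x) (h2 x) \<le> M \<and> gromov_product x (h2 x) (h3 x) \<le> M \<and>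
     gromov_product x (h1 x) (h3 x) \<le> M)"

text \<open>One of two separated orbit points is not in the direction of the fixed end. Its group
  element has an axis, near which all three orbit points lie. Two of them then share one of the two
  directions of the axis, although they are separated.\<close>

lemma (in fixed_end) not_three_directions: "\<not> three_directions \<Gamma> x"
proof
  assume "three_directions \<Gamma> x"
  then obtain M where M: "\<And>R. \<exists>h1\<in>\<Gamma>. \<exists>h2\<in>\<Gamma>. \<exists>h3\<in>\<Gamma>.
     dist x (h1 x) \<ge> R \<and> dist x (h2 x) \<ge> R \<and> dist x (h3 x) \<ge> R \<and>
     gromov_product x (h1 x) (h2 x) \<le> M \<and> gromov_product x (h2 x) (h3 x) \<le> M \<and>
     gromov_product x (h1 x) (h3 x) \<le> M"
    unfolding three_directions_def by metis
  \<comment> \<open>The distance covers both the displacement required by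
    \<open>orbit_near_axis\<close> with \<open>M + \<delta>\<close> in place of \<open>M\<close> and
    products above \<open>M + \<delta>\<close> in \<open>near\<close>.\<close>
  obtain h1 h2 h3 where h: "h1 \<in> \<Gamma>" "h2 \<in> \<Gamma>" "h3 \<in> \<Gamma>"
    and far: "\<And>h. h \<in> {h1, h2, h3} \<Longrightarrow> dist x (h x) \<ge> 2 * M + 7 * \<delta> + 1"
    and apart: "gromov_product x (h1 x) (h2 x) \<le> M" "gromov_product x (h2 x) (h3 x) \<le> M"
      "gromov_product x (h1 x) (h3 x) \<le> M"
    using M[of "2 * M + 7 * \<delta> + 1"] by blast
  have M0: "M \<ge> 0"
    using apart(1) gromov_product_nonneg order_trans by blast
  have "gromov_product x (h1 x) v \<le> M + \<delta> \<or> gromov_product x (h2 x) v \<le> M + \<delta>" for v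
    using product_le[OF apart(1), of v] by (auto simp: gromov_product_commute[of x v])
  then have "\<exists>\<^sub>F v in F. gromov_product x (h1 x) v \<le> M + \<delta> \<or> gromov_product x (h2 x) v \<le> M + \<delta>"
    using nontrivial by (simp add: frequently_def trivial_limit_def)
  then obtain g where g: "g \<in> {h1, h2}" "\<exists>\<^sub>F v in F. gromov_product x (g x) v \<le> M + \<delta>"
    by (auto simp: frequently_disj_iff)
  \<comment> \<open>The bound for \<open>g\<close> holds only frequently along \<open>F\<close>. On
    this finer filter it holds eventually, and the end is still fixed.\<close>
  define F' where "F' = inf F (principal {v. gromov_product x (g x) v \<le> M + \<delta>})"
  interpret F': fixed_end \<Gamma> \<delta> F' x
  proof
    show "F' \<noteq> bot"
      using g(2) by (simp add: F'_def trivial_limit_def eventually_inf_principal frequently_def)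
    show "filterlim (\<lambda>v. gromov_product x v (f v)) at_top F'" if "f \<in> \<Gamma>" for f
      using fixed[OF that] by (rule filterlim_mono) (auto simp: F'_def)
  qed
  have ev: "\<forall>\<^sub>F v in F'. gromov_product x (g x) v \<le> M + \<delta>"
    by (simp add: F'_def eventually_inf_principal)
  have large: "dist x (g x) \<ge> 2 * (M + \<delta>) + 4 * \<delta> + 1"
    using far[of g] g(1) delta_nonneg by auto
  have mem: "g \<in> \<Gamma>" "{h1, h2, h3} \<subseteq> \<Gamma>" and M': "M + \<delta> \<ge> 0"
    using g(1) h M0 delta_nonneg by auto
  obtain p q where pq: "\<And>h. h \<in> {h1, h2, h3} \<Longrightarrow>
      gromov_product x p (h x) \<ge> dist x (h x) - (M + \<delta>) - 5 * \<delta> \<or>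
      gromov_product x q (h x) \<ge> dist x (h x) - (M + \<delta>) - 5 * \<delta>"
    using F'.orbit_near_axis[OF mem(1) ev M' large _ mem(2)] by blast
  have near: "gromov_product x (h x) p > M + \<delta> \<or> gromov_product x (h x) q > M + \<delta>"
    if "h \<in> {h1, h2, h3}" for h
    using pq[OF that] far[OF that] unfolding gromov_product_commute[of x _ "h x"] by linarith
  have "\<not> (gromov_product x y r > M + \<delta> \<and> gromov_product x z r > M + \<delta>)"
    if "gromov_product x y z \<le> M" for y z r
    using product_le[OF that, of r] by (auto simp: gromov_product_commute[of x r])
  from this[OF apart(1)] this[OF apart(2)] this[OF apart(3)] show False
    using near[of h1] near[of h2] near[of h3] by blast
qed

section \<open>Counting group elements\<close>

lemma card_le_mult_fibres:
  assumes "finite B" "f ` A \<subseteq> B" "\<And>b. b \<in> B \<Longrightarrow> finite {a \<in> A. f a = b} \<and> card {a \<in> A. f a = b} \<le> K"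
  shows "card A \<le> K * card B"
proof -
  have "card A \<le> card (\<Union>b\<in>B. {a \<in> A. f a = b})"
    using assms by (intro card_mono) auto
  also have "\<dots> \<le> (\<Sum>b\<in>B. card {a \<in> A. f a = b})"
    using assms(1) by (rule card_UN_le)
  also have "\<dots> \<le> K * card B"
    using sum_bounded_above[of B "\<lambda>b. card {a \<in> A. f a = b}" K] assms(3) by (simp add: mult.commute)
  finally show ?thesis .
qed

context discrete_hyperbolic_group
begin

text \<open>
  If no such bounds existed, the points \<open>v\<close> violating ever larger bounds would define a point
  at infinity fixed by the group.
\<close>

lemma separating_elements:
  assumes "three_directions \<Gamma> x"
  shows "\<exists>N C. \<forall>u v. \<exists>f\<in>\<Gamma>. dist x (f x) \<le> N \<and> gromov_product x u (f v) \<le> C"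
proof (rule ccontr)
  assume contra: "\<not> ?thesis"
  have "\<exists>u v. \<forall>f\<in>\<Gamma>. dist x (f x) \<le> real n \<longrightarrow> gromov_product x u (f v) > real n" for n
    using contra by (meson linorder_not_le)
  then obtain u v where uv: "\<And>n f. f \<in> \<Gamma> \<Longrightarrow> dist x (f x) \<le> real n \<Longrightarrow>
      gromov_product x (u n) (f (v n)) > real n"
    by metis
  interpret fixed_end \<Gamma> \<delta> "filtermap v sequentially" x
  proof
    fix f assume f: "f \<in> \<Gamma>"
    show "filterlim (\<lambda>v. gromov_product x v (f v)) at_top (filtermap v sequentially)"
      unfolding filterlim_at_top eventually_filtermap
    proof
      fix Z
      have "\<forall>\<^sub>F n in sequentially. real n \<ge> max (dist x (f x)) (Z + \<delta>)"
        using filterlim_real_sequentially unfolding filterlim_at_top by blast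
      then show "\<forall>\<^sub>F n in sequentially. Z \<le> gromov_product x (v n) (f (v n))"
      proof eventually_elim
        case (elim n)
        \<comment> \<open>The point \<open>u n\<close> mediates between \<open>v n\<close> and
          \<open>f (v n)\<close>: the choice of \<open>u\<close> and \<open>v\<close> is used for
          \<open>id\<close> and for \<open>f\<close>.\<close>
        have "gromov_product x (v n) (u n) \<ge> n"
          using uv[OF id_mem, of n] by (simp add: gromov_product_commute)
        moreover have "gromov_product x (u n) (f (v n)) \<ge> n"
          using uv[OF f, of n] elim by simp
        ultimately have "gromov_product x (v n) (f (v n)) \<ge> n - \<delta>"
          by (rule product_ge)
        then show ?case
          using elim by simp
      qed
    qed
  qed (simp add: filtermap_bot_iff)
  show False
    using not_three_directions assms by blast
qed

text \<open>Left translation by the inverse of \<open>g0\<close> is injective and moves the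
  comparison point \<open>g0 x\<close> to \<open>x\<close>.\<close>

lemma card_near_le:
  assumes g0: "g0 \<in> \<Gamma>"
  shows "finite {g \<in> \<Gamma>. dist (g x) (g0 x) \<le> D}"
    and "card {g \<in> \<Gamma>. dist (g x) (g0 x) \<le> D} \<le> card {k \<in> \<Gamma>. dist x (k x) \<le> D}"
proof -
  have inj: "inj_on (\<lambda>g. inv_into UNIV g0 \<circ> g) {g \<in> \<Gamma>. dist (g x) (g0 x) \<le> D}"
  proof (rule inj_onI)
    fix g g' :: "'a \<Rightarrow> 'a"
    assume "inv_into UNIV g0 \<circ> g = inv_into UNIV g0 \<circ> g'"
    then show "g = g'"
      using g0 by (metis (no_types, lifting) apply_inv comp_apply ext)
  qed
  have image: "(\<lambda>g. inv_into UNIV g0 \<circ> g) ` {g \<in> \<Gamma>. dist (g x) (g0 x) \<le> D} \<subseteq> {k \<in> \<Gamma>. dist x (k x) \<le> D}"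
    using g0 by (auto intro!: comp_mem inv_mem) (metis dist_commute dist_inv_left)
  show "finite {g \<in> \<Gamma>. dist (g x) (g0 x) \<le> D}"
    using inj image finite_displacement by (rule inj_on_finite)
  show "card {g \<in> \<Gamma>. dist (g x) (g0 x) \<le> D} \<le> card {k \<in> \<Gamma>. dist x (k x) \<le> D}"
    using inj image finite_displacement by (rule card_inj_on_le)
qed

section \<open>Almost supermultiplicativity of the counting function\<close>

text \<open>Group elements are counted rather than orbit points so that factors can be cancelled;
  the strict inequality matches the open ball in \<open>orbit_growth\<close>.\<close>

definition displacement_ball :: "'a \<Rightarrow> real \<Rightarrow> ('a \<Rightarrow> 'a) set" where
  "displacement_ball x S = {g \<in> \<Gamma>. dist x (g x) < S}"

definition annulus :: "'a \<Rightarrow> nat \<Rightarrow> ('a \<Rightarrow> 'a) set" where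
  "annulus x n = {g \<in> \<Gamma>. real n \<le> dist x (g x) \<and> dist x (g x) < real n + 1}"

lemma finite_displacement_ball: "finite (displacement_ball x S)"
  by (rule finite_subset[OF _ finite_displacement[of x S]]) (auto simp: displacement_ball_def)

lemma finite_annulus: "finite (annulus x n)"
  by (rule finite_subset[OF _ finite_displacement[of x "real n + 1"]]) (auto simp: annulus_def)

text \<open>
  A separating element \<open>f\<close> makes \<open>g x\<close> lie near a geodesic from \<open>x\<close> to \<open>(g \<circ> f \<circ> h) x\<close>. As its
  distance from \<open>x\<close> is known up to an error of 1, the product and \<open>f\<close> determine \<open>g\<close> up to
  boundedly many choices.
\<close>

lemma card_annulus_times_ball_le:
  assumes sep: "\<And>u v. \<exists>f\<in>\<Gamma>. dist x (f x) \<le> N \<and> gromov_product x u (f v) \<le> C"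
  shows "card (annulus x n) * card (displacement_ball x S) \<le>
    card {k \<in> \<Gamma>. dist x (k x) \<le> 2 * (1 + C + \<delta>)} *
      (card (displacement_ball x (S + n + (N + 1))) * card {f \<in> \<Gamma>. dist x (f x) \<le> N})"
proof -
  obtain s where s: "\<And>u v. s u v \<in> \<Gamma> \<and> dist x (s u v x) \<le> N \<and> gromov_product x u (s u v v) \<le> C"
    using sep by metis
  define f where "f g h = s (inv_into UNIV g x) (h x)" for g h
  \<comment> \<open>The separating element is recorded as well, since it depends on both
    \<open>g\<close> and \<open>h\<close>.\<close>
  define \<phi> where "\<phi> = (\<lambda>(g, h). (g \<circ> f g h \<circ> h, f g h))"
  let ?A = "annulus x n \<times> displacement_ball x S"
  let ?B = "displacement_ball x (S + n + (N + 1)) \<times> {f \<in> \<Gamma>. dist x (f x) \<le> N}"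
  have f_mem: "f g h \<in> \<Gamma>" and f_le: "dist x (f g h x) \<le> N" for g h
    using s by (auto simp: f_def)
  have "card ?A \<le> card {k \<in> \<Gamma>. dist x (k x) \<le> 2 * (1 + C + \<delta>)} * card ?B"
  proof (rule card_le_mult_fibres[where f = \<phi>])
    show "finite ?B"
      by (simp add: finite_displacement_ball finite_displacement)
    show "\<phi> ` ?A \<subseteq> ?B"
    proof
      fix b assume "b \<in> \<phi> ` ?A"
      then obtain g h where gh: "g \<in> annulus x n" "h \<in> displacement_ball x S" "b = \<phi> (g, h)"
        by auto
      then have mem: "g \<in> \<Gamma>" "h \<in> \<Gamma>"
        by (auto simp: annulus_def displacement_ball_def)
      have "dist x (g (f g h (h x))) \<le> dist x (g x) + (dist x (f g h x) + dist x (h x))"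
        using dist_comp_le[OF mem(1), of x "f g h \<circ> h"] dist_comp_le[OF f_mem, of x g h h] by simp
      then have "dist x (g (f g h (h x))) < S + n + (N + 1)"
        using gh f_le[of g h] by (simp add: annulus_def displacement_ball_def)
      then show "b \<in> ?B"
        using gh(3) mem f_mem f_le by (simp add: \<phi>_def displacement_ball_def comp_mem)
    qed
    fix b assume "b \<in> ?B"
    show "finite {a \<in> ?A. \<phi> a = b} \<and>
      card {a \<in> ?A. \<phi> a = b} \<le> card {k \<in> \<Gamma>. dist x (k x) \<le> 2 * (1 + C + \<delta>)}"
    proof (cases "{a \<in> ?A. \<phi> a = b} = {}")
      case True
      show ?thesis
        unfolding True by simp
    next
      case False
      then obtain g0 h0 where gh0: "g0 \<in> annulus x n" "h0 \<in> displacement_ball x S" "\<phi> (g0, h0) = b"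
        by auto
      have g0: "g0 \<in> \<Gamma>"
        using gh0 by (simp add: annulus_def)
      have product: "gromov_product x (g x) (fst b x) \<ge> n - C"
        if gh: "g \<in> annulus x n" "\<phi> (g, h) = b" for g h
      proof -
        have g: "g \<in> \<Gamma>"
          using gh by (simp add: annulus_def)
        have "gromov_product (g x) x (fst b x) = gromov_product x (inv_into UNIV g x) (f g h (h x))"
          using gromov_product_image[OF g, of x "inv_into UNIV g x" "f g h (h x)"] gh(2) g
          by (auto simp: \<phi>_def)
        also have "\<dots> \<le> C"
          using s by (simp add: f_def)
        finally show ?thesis
          using gromov_product_swap_base[of x "g x" "fst b x"] gh(1) by (simp add: annulus_def)
      qed
      \<comment> \<open>Within a fibre \<open>g\<close> determines \<open>h\<close>, by cancelling
        \<open>g\<close> and the recorded element in the product.\<close>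
      have inj: "inj_on fst {a \<in> ?A. \<phi> a = b}"
      proof (rule inj_onI)
        fix a a'
        assume a: "a \<in> {a \<in> ?A. \<phi> a = b}" "a' \<in> {a \<in> ?A. \<phi> a = b}" and eq: "fst a = fst a'"
        define g where "g = fst a"
        have split: "a = (g, snd a)" "a' = (g, snd a')"
          using eq by (simp_all add: g_def prod_eq_iff)
        have "\<phi> (g, snd a') = \<phi> (g, snd a)" "g \<in> \<Gamma>"
          using a split by (auto simp: annulus_def g_def)
        then have "g (f g (snd a) (snd a' y)) = g (f g (snd a) (snd a y))" for y
          by (auto simp: \<phi>_def fun_eq_iff)
        then have "snd a' y = snd a y" for y
          using f_mem[of g "snd a"] \<open>g \<in> \<Gamma>\<close> by (metis inv_apply)
        then show "a = a'"
          using split by (metis ext)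
      qed
      \<comment> \<open>The points \<open>g x\<close> and \<open>g0 x\<close> have distance less
        than \<open>n + 1\<close> from \<open>x\<close> and product at least
        \<open>n - C - \<delta>\<close>, hence they are close.\<close>
      have image: "fst ` {a \<in> ?A. \<phi> a = b} \<subseteq> {g \<in> \<Gamma>. dist (g x) (g0 x) \<le> 2 * (1 + C + \<delta>)}"
      proof
        fix g assume "g \<in> fst ` {a \<in> ?A. \<phi> a = b}"
        then obtain h where gh: "g \<in> annulus x n" "\<phi> (g, h) = b"
          by auto
        have "gromov_product x (fst b x) (g0 x) \<ge> n - C"
          using product[OF gh0(1,3)] by (simp add: gromov_product_commute)
        with product[OF gh] have "gromov_product x (g x) (g0 x) \<ge> n - C - \<delta>"
          by (rule product_ge)
        then show "g \<in> {g \<in> \<Gamma>. dist (g x) (g0 x) \<le> 2 * (1 + C + \<delta>)}"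
          using gh(1) gh0(1) dist_eq_gromov_product[of "g x" "g0 x" x] by (auto simp: annulus_def)
      qed
      show ?thesis
        using inj_on_finite[OF inj image card_near_le(1)[OF g0]]
          card_inj_on_le[OF inj image card_near_le(1)[OF g0]] card_near_le(2)[OF g0] order_trans
        by blast
    qed
  qed
  then show ?thesis
    by (simp add: card_cartesian_product)
qed

section \<open>Orbit points versus group elements, and change of base point\<close>

lemma finite_orbit_ball: "finite (orbit \<Gamma> x \<inter> ball x T)"
  and card_orbit_ball_le: "card (orbit \<Gamma> x \<inter> ball x T) \<le> card (displacement_ball x T)"
proof -
  have eq: "orbit \<Gamma> x \<inter> ball x T = (\<lambda>g. g x) ` displacement_ball x T"
    by (auto simp: orbit_def displacement_ball_def)
  show "finite (orbit \<Gamma> x \<inter> ball x T)"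
    unfolding eq using finite_displacement_ball by (rule finite_imageI)
  show "card (orbit \<Gamma> x \<inter> ball x T) \<le> card (displacement_ball x T)"
    unfolding eq using finite_displacement_ball by (rule card_image_le)
qed

text \<open>The fibres of evaluation at \<open>x\<close> lie in cosets of the stabilizer, which is
  written as the set of elements of displacement at most 0.\<close>

lemma card_displacement_ball_le:
  "card (displacement_ball x T) \<le> card {k \<in> \<Gamma>. dist x (k x) \<le> 0} * card (orbit \<Gamma> x \<inter> ball x T)"
proof (rule card_le_mult_fibres[where f = "\<lambda>g. g x"])
  show "(\<lambda>g. g x) ` displacement_ball x T \<subseteq> orbit \<Gamma> x \<inter> ball x T"
    by (auto simp: orbit_def displacement_ball_def)
  fix b assume "b \<in> orbit \<Gamma> x \<inter> ball x T"
  then obtain g0 where g0: "g0 \<in> \<Gamma>" "b = g0 x"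
    by (auto simp: orbit_def)
  have sub: "{g \<in> displacement_ball x T. g x = b} \<subseteq> {g \<in> \<Gamma>. dist (g x) (g0 x) \<le> 0}"
    by (auto simp: displacement_ball_def g0)
  show "finite {g \<in> displacement_ball x T. g x = b} \<and>
      card {g \<in> displacement_ball x T. g x = b} \<le> card {k \<in> \<Gamma>. dist x (k x) \<le> 0}"
    using finite_subset[OF sub card_near_le(1)[OF g0(1)]]
      card_mono[OF card_near_le(1)[OF g0(1)] sub] card_near_le(2)[OF g0(1)] order_trans by blast
qed (rule finite_orbit_ball)

lemma displacement_ball_base_change:
  "displacement_ball x T \<subseteq> displacement_ball y (T + 2 * dist x y)"
proof
  fix g assume g: "g \<in> displacement_ball x T"
  have "dist y (g y) \<le> dist y x + dist x (g x) + dist (g x) (g y)"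
    using dist_triangle[of y "g y" x] dist_triangle[of x "g y" "g x"] by linarith
  then show "g \<in> displacement_ball y (T + 2 * dist x y)"
    using g dist_image[of g x y] by (simp add: displacement_ball_def dist_commute)
qed

lemma card_orbit_ball_ge_1:
  assumes "T > 0"
  shows "card (orbit \<Gamma> x \<inter> ball x T) \<ge> 1"
proof -
  have "x \<in> orbit \<Gamma> x \<inter> ball x T"
    using imageI[OF id_mem, of "\<lambda>g. g x"] assms by (simp add: orbit_def)
  then show ?thesis
    using finite_orbit_ball by (metis One_nat_def Suc_leI card_gt_0_iff empty_iff)
qed

lemma card_stabilizer_pos: "card {k \<in> \<Gamma>. dist x (k x) \<le> 0} > 0"
proof -
  have "id \<in> {k \<in> \<Gamma>. dist x (k x) \<le> 0}"
    using id_mem by simp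
  then show ?thesis
    using finite_displacement card_gt_0_iff by (metis empty_iff)
qed

text \<open>For group elements the change of base point is an inclusion of displacement balls;
  returning to orbit points costs the order of a stabilizer.\<close>

lemma Limsup_orbit_growth_base_change:
  "Limsup at_top (orbit_growth \<Gamma> x) \<le> Limsup at_top (orbit_growth \<Gamma> y)"
  unfolding orbit_growth_def
proof (rule Limsup_ln_growth_le)
  let ?s = "card {k \<in> \<Gamma>. dist y (k y) \<le> 0}"
  show "real ?s > 0"
    using card_stabilizer_pos by simp
  show "2 * dist x y \<ge> 0"
    by simp
  fix T :: real
  have "card (orbit \<Gamma> x \<inter> ball x T) \<le> card (displacement_ball x T)"
    by (rule card_orbit_ball_le)
  also have "\<dots> \<le> card (displacement_ball y (T + 2 * dist x y))"
    by (intro card_mono finite_displacement_ball displacement_ball_base_change)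
  also have "\<dots> \<le> ?s * card (orbit \<Gamma> y \<inter> ball y (T + 2 * dist x y))"
    by (rule card_displacement_ball_le)
  finally show "real (card (orbit \<Gamma> x \<inter> ball x T)) \<le>
      real ?s * real (card (orbit \<Gamma> y \<inter> ball y (T + 2 * dist x y)))"
    by (simp only: of_nat_le_iff flip: of_nat_mult)
qed (use card_orbit_ball_ge_1 in \<open>simp_all add: Suc_leI\<close>)

lemma critical_exponent_eq: "critical_exponent \<Gamma> = Limsup at_top (orbit_growth \<Gamma> x)"
  unfolding critical_exponent_def
proof (rule the_equality)
  show "\<forall>y. Limsup at_top (orbit_growth \<Gamma> y) = Limsup at_top (orbit_growth \<Gamma> x)"
    using Limsup_orbit_growth_base_change by (blast intro: antisym)
  fix h assume "\<forall>y. Limsup at_top (orbit_growth \<Gamma> y) = h"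
  then show "h = Limsup at_top (orbit_growth \<Gamma> x)"
    by simp
qed

lemma Limsup_orbit_growth_le_Liminf:
  assumes "three_directions \<Gamma> x"
  shows "Limsup at_top (orbit_growth \<Gamma> x) \<le> Liminf at_top (orbit_growth \<Gamma> x)"
proof -
  obtain N C where sep: "\<And>u v. \<exists>f\<in>\<Gamma>. dist x (f x) \<le> N \<and> gromov_product x u (f v) \<le> C"
    using separating_elements[OF assms] by metis
  define s where "s = card {k \<in> \<Gamma>. dist x (k x) \<le> 0}"
  define A where "A = card {k \<in> \<Gamma>. dist x (k x) \<le> 2 * (1 + C + \<delta>)}"
  define B where "B = card {f \<in> \<Gamma>. dist x (f x) \<le> N}"
  obtain f where "dist x (f x) \<le> N" "gromov_product x x (f x) \<le> C"
    using sep[of x x] by blast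
  then have N: "N \<ge> 0" and C: "C \<ge> 0"
    using zero_le_dist[of x "f x"] gromov_product_nonneg[of x x "f x"] by linarith+
  have pos: "card {k \<in> \<Gamma>. dist x (k x) \<le> R} > 0" if "R \<ge> 0" for R
    using that by (intro less_le_trans[OF card_stabilizer_pos[of x] card_mono[OF finite_displacement]]) auto
  show ?thesis
    unfolding orbit_growth_def
  \<comment> \<open>In \<open>K\<close>, \<open>A\<close> bounds the choices of \<open>g\<close>
    near a given one, \<open>B\<close> counts the possible separating elements, and \<open>s\<close>
    is the order of the stabilizer.\<close>
  proof (rule Limsup_le_Liminf_supermultiplicative
      [where K = "real (A * B * s)" and c = "N + 1" and a = "\<lambda>n. real (card (annulus x n))"])
    show "real (A * B * s) > 0"
      using pos[of "2 * (1 + C + \<delta>)"] pos[of N] pos[of 0] N C delta_nonneg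
      by (simp add: A_def B_def s_def)
    show "real (card (orbit \<Gamma> x \<inter> ball x S)) \<le> real (card (orbit \<Gamma> x \<inter> ball x T))" if "S \<le> T" for S T
      using that by (intro of_nat_mono card_mono finite_orbit_ball) auto
  next
    fix n :: nat and S :: real
    have "card (annulus x n) * card (orbit \<Gamma> x \<inter> ball x S) \<le> card (annulus x n) * card (displacement_ball x S)"
      by (intro mult_le_mono2 card_orbit_ball_le)
    also have "\<dots> \<le> A * (card (displacement_ball x (S + n + (N + 1))) * B)"
      unfolding A_def B_def using sep by (rule card_annulus_times_ball_le)
    also have "\<dots> \<le> A * ((s * card (orbit \<Gamma> x \<inter> ball x (S + n + (N + 1)))) * B)"
      unfolding s_def by (intro mult_le_mono1 mult_le_mono2 card_displacement_ball_le)
    also have "\<dots> = A * B * s * card (orbit \<Gamma> x \<inter> ball x (S + n + (N + 1)))"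
      by simp
    finally show "real (card (annulus x n)) * real (card (orbit \<Gamma> x \<inter> ball x S)) \<le>
        real (A * B * s) * real (card (orbit \<Gamma> x \<inter> ball x (S + n + (N + 1))))"
      by (simp only: of_nat_le_iff flip: of_nat_mult)
  next
    fix T :: real
    assume T: "T > 0"
    have "displacement_ball x T \<subseteq> (\<Union>n\<le>nat \<lfloor>T\<rfloor>. annulus x n)"
    proof
      fix g assume g: "g \<in> displacement_ball x T"
      let ?n = "nat \<lfloor>dist x (g x)\<rfloor>"
      have "g \<in> annulus x ?n"
        using g by (auto simp: displacement_ball_def annulus_def)
      moreover have "?n \<le> nat \<lfloor>T\<rfloor>"
        using g by (intro nat_mono floor_mono) (simp add: displacement_ball_def)
      ultimately show "g \<in> (\<Union>n\<le>nat \<lfloor>T\<rfloor>. annulus x n)"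
        by blast
    qed
    then have "card (displacement_ball x T) \<le> card (\<Union>n\<le>nat \<lfloor>T\<rfloor>. annulus x n)"
      by (intro card_mono) (auto simp: finite_annulus)
    also have "\<dots> \<le> (\<Sum>n\<le>nat \<lfloor>T\<rfloor>. card (annulus x n))"
      by (intro card_UN_le) simp
    finally have "card (orbit \<Gamma> x \<inter> ball x T) \<le> (\<Sum>n\<le>nat \<lfloor>T\<rfloor>. card (annulus x n))"
      using card_orbit_ball_le order_trans by blast
    then show "real (card (orbit \<Gamma> x \<inter> ball x T)) \<le> (\<Sum>n\<le>nat \<lfloor>T\<rfloor>. real (card (annulus x n)))"
      by (metis of_nat_le_iff of_nat_sum)
  qed (use card_orbit_ball_ge_1 N in \<open>simp_all add: Suc_leI\<close>)
qed

end

section \<open>Limit points of orbits\<close>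

lemma eventually_prod_sequentially_iff:
  "(\<forall>\<^sub>F (i, j) in sequentially \<times>\<^sub>F sequentially. P i j) \<longleftrightarrow> (\<exists>N. \<forall>i\<ge>N. \<forall>j\<ge>N. P i j)"
  unfolding eventually_prod_sequentially prod.case by blast

lemma diverging_product_iff:
  "diverging_product s t \<longleftrightarrow> (\<forall>w Z. \<exists>N. \<forall>i\<ge>N. \<forall>j\<ge>N. gromov_product w (s i) (t j) \<ge> Z)"
  unfolding diverging_product_def filterlim_at_top eventually_prod_sequentially_iff[symmetric]
  by (simp add: case_prod_unfold)

lemma diverging_product_commute: "diverging_product s t \<Longrightarrow> diverging_product t s"
  unfolding diverging_product_iff by (metis gromov_product_commute)

lemma extended_product_gt_obtain:
  assumes "extended_product w p q > ereal r"
  obtains s t N where "represents s p" "represents t q"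
    "\<And>i j. i \<ge> N \<Longrightarrow> j \<ge> N \<Longrightarrow> gromov_product w (s i) (t j) > r"
proof -
  obtain s t where st: "represents s p" "represents t q"
    "Liminf (sequentially \<times>\<^sub>F sequentially) (\<lambda>(i, j). ereal (gromov_product w (s i) (t j))) > ereal r"
    using assms unfolding extended_product_def less_Sup_iff by auto
  then have "\<forall>\<^sub>F (i, j) in sequentially \<times>\<^sub>F sequentially. gromov_product w (s i) (t j) > r"
    using less_LiminfD[OF st(3)] by (simp add: case_prod_unfold)
  then show ?thesis
    unfolding eventually_prod_sequentially_iff using st(1,2) that by blast
qed

lemma extended_product_ge:
  assumes "represents s p" "represents t q"
    and "\<And>i j. i \<ge> N \<Longrightarrow> j \<ge> N \<Longrightarrow> gromov_product w (s i) (t j) \<ge> r"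
  shows "extended_product w p q \<ge> ereal r"
proof -
  have "\<forall>\<^sub>F (i, j) in sequentially \<times>\<^sub>F sequentially. gromov_product w (s i) (t j) \<ge> r"
    unfolding eventually_prod_sequentially_iff using assms(3) by blast
  then have "ereal r \<le> Liminf (sequentially \<times>\<^sub>F sequentially) (\<lambda>(i, j). ereal (gromov_product w (s i) (t j)))"
    by (intro Liminf_bounded) (simp add: case_prod_unfold)
  also have "\<dots> \<le> extended_product w p q"
    unfolding extended_product_def by (rule Sup_upper) (use assms(1,2) in blast)
  finally show ?thesis .
qed

lemma extended_product_base_change:
  assumes "extended_product w p q > ereal (r + dist w x)"
  shows "extended_product x p q \<ge> ereal r"
proof -
  obtain s t N where st: "represents s p" "represents t q"
    and N: "\<And>i j. i \<ge> N \<Longrightarrow> j \<ge> N \<Longrightarrow> gromov_product w (s i) (t j) > r + dist w x"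
    using extended_product_gt_obtain[OF assms] by metis
  have "gromov_product x (s i) (t j) \<ge> r" if "i \<ge> N" "j \<ge> N" for i j
    using N[OF that] gromov_product_base_lipschitz[of w "s i" "t j" x] by linarith
  then show ?thesis
    using st by (intro extended_product_ge)
qed

section \<open>Boundary points of a hyperbolic space and their neighbourhoods\<close>

context
  fixes \<delta> :: real
  assumes hyperbolic: "hyperbolic_space TYPE('a::metric_space) \<delta>"
begin

lemma diverging_product_trans:
  fixes s t u :: "nat \<Rightarrow> 'a"
  assumes "diverging_product s t" "diverging_product t u"
  shows "diverging_product s u"
  unfolding diverging_product_iff
proof (intro allI)
  fix w Z
  obtain N1 where N1: "\<forall>i\<ge>N1. \<forall>j\<ge>N1. gromov_product w (s i) (t j) \<ge> Z + \<delta>"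
    using assms(1) unfolding diverging_product_iff by blast
  obtain N2 where N2: "\<forall>i\<ge>N2. \<forall>j\<ge>N2. gromov_product w (t i) (u j) \<ge> Z + \<delta>"
    using assms(2) unfolding diverging_product_iff by blast
  let ?N = "max N1 N2"
  have "gromov_product w (s i) (u j) \<ge> Z" if "i \<ge> ?N" "j \<ge> ?N" for i j
    using gromov_product_ge[OF hyperbolic, of "Z + \<delta>" w "s i" "t ?N" "u j"] N1 N2 that by simp
  then show "\<exists>N. \<forall>i\<ge>N. \<forall>j\<ge>N. Z \<le> gromov_product w (s i) (u j)"
    by blast
qed

text \<open>A boundary point is a class of \<open>gromov_rel\<close>; transitivity lets any member
  replace the chosen representative.\<close>

lemma mem_boundary_point_iff:
  fixes \<xi> :: "(nat \<Rightarrow> 'a) set"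
  assumes "\<xi> \<in> gromov_boundary" "s \<in> \<xi>"
  shows "t \<in> \<xi> \<longleftrightarrow> t \<in> gromov_sequences \<and> diverging_product s t"
proof -
  obtain r where r: "r \<in> gromov_sequences" "\<xi> = gromov_rel `` {r}"
    using assms(1) by (auto simp: gromov_boundary_def quotient_def)
  have "diverging_product r s"
    using assms(2) r by (auto simp: gromov_rel_def)
  then have "diverging_product r t \<longleftrightarrow> diverging_product s t"
    using diverging_product_trans diverging_product_commute by blast
  then show ?thesis
    using r by (auto simp: gromov_rel_def)
qed

lemma not_diverging_product:
  fixes \<xi> \<zeta> :: "(nat \<Rightarrow> 'a) set"
  assumes "\<xi> \<in> gromov_boundary" "\<zeta> \<in> gromov_boundary" "\<xi> \<noteq> \<zeta>" "s \<in> \<xi>" "t \<in> \<zeta>"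
  shows "\<not> diverging_product s t"
proof
  assume st: "diverging_product s t"
  have "u \<in> \<xi> \<longleftrightarrow> u \<in> \<zeta>" for u
    using mem_boundary_point_iff[OF assms(1,4)] mem_boundary_point_iff[OF assms(2,5)]
      diverging_product_trans diverging_product_commute st by blast
  then show False
    using assms(3) by blast
qed

text \<open>
  The superlevel sets of the extended product need not be open; this is the largest open set
  meeting the space in \<open>U\<close>.
\<close>

lemma bordification_open_extension:
  fixes U :: "'a set"
  assumes "open U"
  shows "bordification_open (Inl ` U \<union>
    Inr ` {\<zeta> \<in> gromov_boundary. \<exists>r::real. \<forall>y. extended_product x (Inl y) (Inr \<zeta>) > ereal r \<longrightarrow> y \<in> U})"
    (is "bordification_open ?V")
  unfolding bordification_open_def
proof (intro conjI allI impI)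
  show "?V \<subseteq> bordification"
    by (auto simp: bordification_def)
  have "Inl -` ?V = U"
    by auto
  then show "open (Inl -` ?V)"
    using assms by simp
  fix \<xi> w
  assume "Inr \<xi> \<in> ?V"
  then obtain r :: real where \<xi>: "\<xi> \<in> gromov_boundary"
    and r: "\<And>y. extended_product x (Inl y) (Inr \<xi>) > ereal r \<Longrightarrow> y \<in> U"
    by auto
  \<comment> \<open>The term \<open>2 * \<delta>\<close> pays for two uses of hyperbolicity in
    passing from \<open>y\<close> through \<zeta> to \<xi>, and 1 yields strictness.\<close>
  define r' where "r' = r + 2 * \<delta> + 1"
  have r_less: "ereal r < ereal r'"
    using hyperbolic_space_nonneg[OF hyperbolic] by (simp add: r'_def)
  \<comment> \<open>The witness is \<open>r' + 1 + dist w x\<close>: the distance pays for the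
    change of base point, and 1 restores the strict inequality lost there.\<close>
  show "\<exists>R::real. {p \<in> bordification. extended_product w p (Inr \<xi>) > ereal R} \<subseteq> ?V"
  proof (intro exI subsetI)
    fix p
    assume "p \<in> {p \<in> bordification. extended_product w p (Inr \<xi>) > ereal (r' + 1 + dist w x)}"
    then have p: "p \<in> bordification" "extended_product x p (Inr \<xi>) \<ge> ereal (r' + 1)"
      using extended_product_base_change by auto
    then have p_gt: "extended_product x p (Inr \<xi>) > ereal r'"
      using less_le_trans[of "ereal r'" "ereal (r' + 1)"] by simp
    show "p \<in> ?V"
    proof (cases p)
      case (Inl y)
      then have "y \<in> U"
        using r[of y] order_less_trans[OF r_less p_gt] by simp
      then show ?thesis
        using Inl by blast
    next
      case (Inr \<zeta>)
      then have \<zeta>: "\<zeta> \<in> gromov_boundary"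
        using p(1) by (auto simp: bordification_def)
      obtain t s N1 where ts: "t \<in> \<zeta>" "s \<in> \<xi>"
        and N1: "\<And>i j. i \<ge> N1 \<Longrightarrow> j \<ge> N1 \<Longrightarrow> gromov_product x (t i) (s j) > r'"
        using extended_product_gt_obtain[OF p_gt] unfolding Inr represents_def by auto
      \<comment> \<open>So \<open>r'\<close> is the radius that puts \<zeta> into the
        extension.\<close>
      have "y \<in> U" if y: "extended_product x (Inl y) (Inr \<zeta>) > ereal r'" for y
      proof -
        obtain a t' N2 where a: "represents a (Inl y)" "t' \<in> \<zeta>"
          and N2: "\<And>i j. i \<ge> N2 \<Longrightarrow> j \<ge> N2 \<Longrightarrow> gromov_product x (a i) (t' j) > r'"
          using extended_product_gt_obtain[OF y] unfolding represents_def by auto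
        have "diverging_product t' t"
          using mem_boundary_point_iff[OF \<zeta> a(2)] ts(1) by blast
        then obtain N3 where N3: "\<And>i j. i \<ge> N3 \<Longrightarrow> j \<ge> N3 \<Longrightarrow> gromov_product x (t' i) (t j) \<ge> r'"
          unfolding diverging_product_iff by blast
        define N where "N = max N1 (max N2 N3)"
        then have N: "N1 \<le> N" "N2 \<le> N" "N3 \<le> N"
          by linarith+
        have "gromov_product x (a i) (s j) \<ge> r + 1" if ij: "i \<ge> N" "j \<ge> N" for i j
        proof -
          have "gromov_product x (a i) (t' N) \<ge> r'" "gromov_product x (t' N) (t N) \<ge> r'"
            using N2[of i N] N3[of N N] ij N by auto
          then have "gromov_product x (a i) (t N) \<ge> r' - \<delta>"
            by (rule gromov_product_ge[OF hyperbolic])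
          moreover have "gromov_product x (t N) (s j) \<ge> r' - \<delta>"
            using N1[of N j] ij N hyperbolic_space_nonneg[OF hyperbolic] by simp
          ultimately have "gromov_product x (a i) (s j) \<ge> r' - \<delta> - \<delta>"
            by (rule gromov_product_ge[OF hyperbolic])
          then show ?thesis
            by (simp add: r'_def)
        qed
        then have "extended_product x (Inl y) (Inr \<xi>) \<ge> ereal (r + 1)"
          using a(1) ts(2) by (intro extended_product_ge[where s = a and t = s and N = N]) (auto simp: represents_def)
        then show ?thesis
          using r[of y] less_le_trans[of "ereal r" "ereal (r + 1)"] by simp
      qed
      then show ?thesis
        using Inr \<zeta> by blast
    qed
  qed
qed

text \<open>The points \<open>y\<close> with the desired property contain an open set whose
  extension to the boundary is a neighbourhood of \<xi>, so accumulation yields a point of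
  \<open>A\<close> in it.\<close>

lemma derived_set_point_approx:
  fixes A :: "'a set"
  assumes \<xi>: "\<xi> \<in> gromov_boundary" "s \<in> \<xi>"
    and derived: "Inr \<xi> \<in> bordification_topology derived_set_of (Inl ` A)"
  obtains y where "y \<in> A" "\<forall>\<^sub>F j in sequentially. gromov_product x y (s j) > R"
proof -
  define U where "U = interior {y. \<forall>\<^sub>F j in sequentially. gromov_product x y (s j) > R}"
  define V where "V = Inl ` U \<union>
    Inr ` {\<zeta> \<in> gromov_boundary. \<exists>r::real. \<forall>y. extended_product x (Inl y) (Inr \<zeta>) > ereal r \<longrightarrow> y \<in> U}"
  \<comment> \<open>Of the constant 3, the amount 2 covers the distance from \<open>a N\<close> to
    any point of \<open>ball y 1\<close>; the rest gives strictness after \<delta> is spent.\<close>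
  have "y \<in> U" if y: "extended_product x (Inl y) (Inr \<xi>) > ereal (R + \<delta> + 3)" for y
  proof -
    obtain a t N1 where a: "a \<longlonglongrightarrow> y" and t: "t \<in> \<xi>"
      and N1: "\<And>i j. i \<ge> N1 \<Longrightarrow> j \<ge> N1 \<Longrightarrow> gromov_product x (a i) (t j) > R + \<delta> + 3"
      using extended_product_gt_obtain[OF y] unfolding represents_def by auto
    obtain N2 where N2: "\<And>i. i \<ge> N2 \<Longrightarrow> dist (a i) y < 1"
      using a unfolding lim_sequentially by (metis zero_less_one)
    have "diverging_product t s"
      using mem_boundary_point_iff[OF \<xi>(1) t] \<xi>(2) by blast
    then obtain N3 where N3: "\<And>i j. i \<ge> N3 \<Longrightarrow> j \<ge> N3 \<Longrightarrow> gromov_product x (t i) (s j) \<ge> R + \<delta> + 1"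
      unfolding diverging_product_iff by blast
    define N where "N = max N1 (max N2 N3)"
    then have N: "N1 \<le> N" "N2 \<le> N" "N3 \<le> N"
      by linarith+
    have "gromov_product x z (s j) > R" if z: "z \<in> ball y 1" and j: "j \<ge> N" for z j
    proof -
      have "dist (a N) z < 2"
        using N2[OF N(2)] z dist_triangle[of "a N" z y] by simp
      then have "gromov_product x z (t N) \<ge> R + \<delta> + 1"
        using N1[OF N(1) N(1)] gromov_product_lipschitz[of x "a N" "t N" z] by simp
      moreover have "gromov_product x (t N) (s j) \<ge> R + \<delta> + 1"
        using N3[of N j] j N(3) by simp
      ultimately have "gromov_product x z (s j) \<ge> R + \<delta> + 1 - \<delta>"
        by (rule gromov_product_ge[OF hyperbolic])
      then show ?thesis
        by simp
    qed
    then have "ball y 1 \<subseteq> {y. \<forall>\<^sub>F j in sequentially. gromov_product x y (s j) > R}"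
      unfolding eventually_sequentially by blast
    then show ?thesis
      unfolding U_def by (meson centre_in_ball interiorI open_ball zero_less_one)
  qed
  then have "Inr \<xi> \<in> V"
    using \<xi>(1) unfolding V_def by blast
  moreover have "openin bordification_topology V"
    unfolding V_def openin_bordification_topology by (rule bordification_open_extension) (simp add: U_def)
  ultimately obtain z where "z \<in> Inl ` A" "z \<in> V"
    using derived unfolding in_derived_set_of by blast
  then obtain y where "y \<in> A" "y \<in> U"
    unfolding V_def by auto
  then show ?thesis
    using that interior_subset unfolding U_def by blast
qed

text \<open>Without divergence, arbitrarily late pairs have product below some \<open>Z\<close> at
  some \<open>w\<close>. A large product of \<open>p\<close> and \<open>q\<close> would carry over
  to such pairs; the bound \<open>M\<close> allows for two uses of hyperbolicity and a change of
  base point.\<close>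

lemma bounded_product_near_distinct_ends:
  fixes s t :: "nat \<Rightarrow> 'a"
  assumes "\<not> diverging_product s t"
  shows "\<exists>M. \<forall>p q. (\<forall>\<^sub>F j in sequentially. gromov_product x p (s j) > M) \<longrightarrow>
    (\<forall>\<^sub>F j in sequentially. gromov_product x q (t j) > M) \<longrightarrow> gromov_product x p q \<le> M"
proof -
  obtain w Z where wZ: "\<And>N. \<exists>i\<ge>N. \<exists>j\<ge>N. gromov_product w (s i) (t j) < Z"
    using assms unfolding diverging_product_iff by (meson linorder_not_le)
  define M where "M = Z + dist x w + 2 * \<delta>"
  have "gromov_product x p q \<le> M"
    if near: "\<forall>\<^sub>F j in sequentially. gromov_product x p (s j) > M"
      "\<forall>\<^sub>F j in sequentially. gromov_product x q (t j) > M" for p q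
  proof (rule ccontr)
    assume pq: "\<not> gromov_product x p q \<le> M"
    obtain N where N: "\<And>j. j \<ge> N \<Longrightarrow> gromov_product x p (s j) > M \<and> gromov_product x q (t j) > M"
      using eventually_conj[OF near] unfolding eventually_sequentially by blast
    obtain i j where ij: "i \<ge> N" "j \<ge> N" "gromov_product w (s i) (t j) < Z"
      using wZ by blast
    have "gromov_product x (s i) p \<ge> M" "gromov_product x p q \<ge> M"
      using N[OF ij(1)] pq by (simp_all add: gromov_product_commute)
    then have "gromov_product x (s i) q \<ge> M - \<delta>"
      by (rule gromov_product_ge[OF hyperbolic])
    moreover have "gromov_product x q (t j) \<ge> M - \<delta>"
      using N[OF ij(2)] hyperbolic_space_nonneg[OF hyperbolic] by simp
    ultimately have "gromov_product x (s i) (t j) \<ge> M - \<delta> - \<delta>"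
      by (rule gromov_product_ge[OF hyperbolic])
    then show False
      using ij(3) gromov_product_base_lipschitz[of x "s i" "t j" w] by (simp add: M_def)
  qed
  then show ?thesis
    by blast
qed

end

section \<open>From three limit points to three directions in the orbit\<close>

text \<open>A limit point may come from the orbit of another point \<open>y\<close>; passing to the
  orbit of \<open>x\<close> costs \<open>dist y x\<close> in the product.\<close>

lemma (in discrete_hyperbolic_group) limit_point_approx:
  assumes "\<xi> \<in> limit_set \<Gamma>" "s \<in> \<xi>"
  obtains g where "g \<in> \<Gamma>" "\<forall>\<^sub>F j in sequentially. gromov_product x (g x) (s j) > R"
proof -
  obtain y where \<xi>: "\<xi> \<in> gromov_boundary"
    "Inr \<xi> \<in> bordification_topology derived_set_of (Inl ` orbit \<Gamma> y)"
    using assms(1) by (auto simp: limit_set_def)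
  obtain z where z: "z \<in> orbit \<Gamma> y" "\<forall>\<^sub>F j in sequentially. gromov_product x z (s j) > R + dist y x"
    using derived_set_point_approx[OF hyperbolic \<xi>(1) assms(2) \<xi>(2)] by blast
  then obtain g where g: "g \<in> \<Gamma>" "z = g y"
    by (auto simp: orbit_def)
  have "gromov_product x (g y) v \<le> gromov_product x (g x) v + dist y x" for v
    using gromov_product_lipschitz[of x "g y" v "g x"] by (simp add: dist_image g)
  then have "\<forall>\<^sub>F j in sequentially. gromov_product x (g x) (s j) > R"
    using z(2) unfolding g(2) by (auto elim!: eventually_mono) (smt (verit))
  then show ?thesis
    using g(1) that by blast
qed

text \<open>Orbit points close to three distinct limit points have bounded pairwise products, and
  closeness to the boundary forces them far from \<open>x\<close>.\<close>

lemma (in discrete_hyperbolic_group) non_elementary_three_directions: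
  assumes "non_elementary \<Gamma>"
  shows "three_directions \<Gamma> x"
proof -
  have "\<exists>T\<subseteq>limit_set \<Gamma>. card T = 3"
  proof (cases "finite (limit_set \<Gamma>)")
    case True
    then have "3 \<le> card (limit_set \<Gamma>)"
      using assms by (simp add: non_elementary_def)
    then show ?thesis
      by (metis obtain_subset_with_card_n)
  next
    case False
    then show ?thesis
      using infinite_arbitrarily_large by blast
  qed
  then obtain \<xi>1 \<xi>2 \<xi>3 where \<xi>: "\<xi>1 \<in> limit_set \<Gamma>" "\<xi>2 \<in> limit_set \<Gamma>" "\<xi>3 \<in> limit_set \<Gamma>"
    and distinct: "\<xi>1 \<noteq> \<xi>2" "\<xi>2 \<noteq> \<xi>3" "\<xi>1 \<noteq> \<xi>3"
    by (auto simp: card_3_iff)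
  have boundary: "\<xi>1 \<in> gromov_boundary" "\<xi>2 \<in> gromov_boundary" "\<xi>3 \<in> gromov_boundary"
    using \<xi> by (auto simp: limit_set_def)
  have "\<exists>s. s \<in> \<xi>" if "\<xi> \<in> gromov_boundary" for \<xi> :: "(nat \<Rightarrow> 'a) set"
    using that by (auto simp: gromov_boundary_def quotient_def gromov_rel_def gromov_sequences_def)
  then obtain s1 s2 s3 where s: "s1 \<in> \<xi>1" "s2 \<in> \<xi>2" "s3 \<in> \<xi>3"
    using boundary by metis
  let ?near = "\<lambda>M p s. \<forall>\<^sub>F j in sequentially. gromov_product x p (s j) > M"
  note bounded = bounded_product_near_distinct_ends[OF hyperbolic not_diverging_product[OF hyperbolic]]
  obtain M12 where M12: "\<And>p q. ?near M12 p s1 \<Longrightarrow> ?near M12 q s2 \<Longrightarrow> gromov_product x p q \<le> M12"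
    using bounded[OF boundary(1,2) distinct(1) s(1,2)] by blast
  obtain M23 where M23: "\<And>p q. ?near M23 p s2 \<Longrightarrow> ?near M23 q s3 \<Longrightarrow> gromov_product x p q \<le> M23"
    using bounded[OF boundary(2,3) distinct(2) s(2,3)] by blast
  obtain M13 where M13: "\<And>p q. ?near M13 p s1 \<Longrightarrow> ?near M13 q s3 \<Longrightarrow> gromov_product x p q \<le> M13"
    using bounded[OF boundary(1,3) distinct(3) s(1,3)] by blast
  define M where "M = max M12 (max M23 M13)"
  have near_mono: "?near L p s" if "?near L' p s" "L \<le> L'" for L L' p s
    using that by (auto elim!: eventually_mono)
  have far: "dist x p \<ge> L" if near: "?near L p s" for L p s
  proof -
    obtain j where "gromov_product x p (s j) > L"
      using eventually_happens[OF near] by auto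
    then show ?thesis
      using gromov_product_le_dist[of x p "s j"] by linarith
  qed
  show ?thesis
    unfolding three_directions_def
  proof (intro exI allI)
    fix R
    \<comment> \<open>The threshold \<open>R\<close> gives the distance and \<open>M\<close> the
      product bounds, so \<open>M\<close> is independent of \<open>R\<close>.\<close>
    define L where "L = max R M"
    have L: "M12 \<le> L" "M23 \<le> L" "M13 \<le> L" "R \<le> L"
      by (auto simp: L_def M_def)
    obtain h1 where h1: "h1 \<in> \<Gamma>" "?near L (h1 x) s1"
      using limit_point_approx[OF \<xi>(1) s(1)] .
    obtain h2 where h2: "h2 \<in> \<Gamma>" "?near L (h2 x) s2"
      using limit_point_approx[OF \<xi>(2) s(2)] .
    obtain h3 where h3: "h3 \<in> \<Gamma>" "?near L (h3 x) s3"
      using limit_point_approx[OF \<xi>(3) s(3)] .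
    have "gromov_product x (h1 x) (h2 x) \<le> M12" "gromov_product x (h2 x) (h3 x) \<le> M23"
      "gromov_product x (h1 x) (h3 x) \<le> M13"
      using M12[OF near_mono[OF h1(2) L(1)] near_mono[OF h2(2) L(1)]]
        M23[OF near_mono[OF h2(2) L(2)] near_mono[OF h3(2) L(2)]]
        M13[OF near_mono[OF h1(2) L(3)] near_mono[OF h3(2) L(3)]] .
    then have "gromov_product x (h1 x) (h2 x) \<le> M" "gromov_product x (h2 x) (h3 x) \<le> M"
      "gromov_product x (h1 x) (h3 x) \<le> M"
      by (auto simp: M_def)
    moreover have "dist x (h1 x) \<ge> R" "dist x (h2 x) \<ge> R" "dist x (h3 x) \<ge> R"
      using far[OF h1(2)] far[OF h2(2)] far[OF h3(2)] L(4) by linarith+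
    ultimately show "\<exists>h1\<in>\<Gamma>. \<exists>h2\<in>\<Gamma>. \<exists>h3\<in>\<Gamma>.
        dist x (h1 x) \<ge> R \<and> dist x (h2 x) \<ge> R \<and> dist x (h3 x) \<ge> R \<and>
        gromov_product x (h1 x) (h2 x) \<le> M \<and> gromov_product x (h2 x) (h3 x) \<le> M \<and>
        gromov_product x (h1 x) (h3 x) \<le> M"
      using h1(1) h2(1) h3(1) by blast
  qed
qed

theorem theorem2:
  fixes \<Gamma> :: "('a::metric_space \<Rightarrow> 'a) set" and x :: 'a and \<delta> :: real
  assumes "proper_space TYPE('a)"
    and "hyperbolic_space TYPE('a) \<delta>"
    and "subgroup \<Gamma> isom_group"
    and "discrete_isometries \<Gamma>"
    and "non_elementary \<Gamma>"
  shows "Limsup at_top (orbit_growth \<Gamma> x) = Liminf at_top (orbit_growth \<Gamma> x) \<and>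
         Liminf at_top (orbit_growth \<Gamma> x) = critical_exponent \<Gamma>"
proof -
  interpret discrete_hyperbolic_group \<Gamma> \<delta>
    by (intro discrete_hyperbolic_group.intro isometry_group.intro
        discrete_hyperbolic_group_axioms.intro assms)
  have "Limsup at_top (orbit_growth \<Gamma> x) \<le> Liminf at_top (orbit_growth \<Gamma> x)"
    using non_elementary_three_directions[OF assms(5)] by (rule Limsup_orbit_growth_le_Liminf)
  then have "Limsup at_top (orbit_growth \<Gamma> x) = Liminf at_top (orbit_growth \<Gamma> x)"
    by (intro antisym Liminf_le_Limsup) simp_all
  then show ?thesis
    using critical_exponent_eq[of x] by simp
qed

end
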